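(* Let $V$ be a complex Banach space, let $A\in L(V)$ be a bounded operator with resolvent $R(z)=(z-A)^{-1}$, and let $M$ be the spectral Schwartz distribution of a resolvent distribution that is defined on the whole complex plane and extends the resolvent function $R(z)$. Then the support of $M$ is compact, so that $M(1)$ is defined (where $1$ is the constant function $1$), and $$M(1)=\int d^2z\,M(z)=1_{L(V)} .$$
   Context: $L(V)$ is the Banach algebra of bounded operators on $V$, with identity $1_{L(V)}$; $\mathcal{D}(\mathbb{C})$ is the space of $C^\infty$ functions with compact support on $\mathbb{C}$; $d^2z=dx\,dy$. An $L(V)$-valued distribution is a linear map $\mathcal{D}(\mathbb{C})\to L(V)$, continuous in Schwartz's sense. $\overline{\partial}=\frac12(\partial_x+i\partial_y)$ and $(\overline{\partial}T)(\varphi)=-T(\overline{\partial}\varphi)$. A resolvent distribution on $\mathbb{C}$ is an $L(V)$-valued distribution $R$ such that for all $\varphi_1,\varphi_2\in\mathcal{D}(\mathbb{C})$ $$R(\varphi_1)R(\varphi_2)=\int d^2z_1\,R(z_1)\varphi_1(z_1)\int d^2z_2\,\frac{\varphi_2(z_2)}{z_2-z_1}-\int d^2z_2\,R(z_2)\varphi_2(z_2)\int d^2z_1\,\frac{\varphi_1(z_1)}{z_2-z_1}.$$ Its spectral Schwartz distribution is $M=\frac1\pi\overline{\partial}R$. It extends the resolvent function of $A$ if its restriction to the resolvent set of $A$ is the distribution given by the function $z\mapsto(z-A)^{-1}$. For a distribution $M$ of compact support, $M(1)$ means $M(\varphi)$ for any test function $\varphi$ equal to $1$ on a neighborhood of the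 support. *)

theory Defs
  imports "HOL-Analysis.Analysis"
begin

section \<open>Complex Banach spaces\<close>

class complex_normed_vector = real_normed_vector +
  fixes scaleC :: "complex \<Rightarrow> 'a \<Rightarrow> 'a" (infixr \<open>*\<^sub>C\<close> 75)
  assumes scaleC_add_right: "c *\<^sub>C (x + y) = c *\<^sub>C x + c *\<^sub>C y"
    and scaleC_add_left: "(c + d) *\<^sub>C x = c *\<^sub>C x + d *\<^sub>C x"
    and scaleC_scaleC: "c *\<^sub>C d *\<^sub>C x = (c * d) *\<^sub>C x"
    and scaleC_of_real: "complex_of_real r *\<^sub>C x = r *\<^sub>R x"
    and norm_scaleC: "norm (c *\<^sub>C x) = cmod c * norm x"

class complex_banach = complex_normed_vector + banach

instantiation complex :: complex_banach
begin
definition scaleC_complex :: "complex \<Rightarrow> complex \<Rightarrow> complex"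
  where "scaleC_complex c x = c * x"
instance
  by standard (simp_all add: scaleC_complex_def algebra_simps norm_mult scaleR_conv_of_real)
end

lemma bounded_bilinear_scaleC:
  "bounded_bilinear ((*\<^sub>C) :: complex \<Rightarrow> 'a \<Rightarrow> 'a::complex_normed_vector)"
proof
  fix c d :: complex and x y :: 'a and r :: real
  show "(c + d) *\<^sub>C x = c *\<^sub>C x + d *\<^sub>C x" by (rule scaleC_add_left)
  show "c *\<^sub>C (x + y) = c *\<^sub>C x + c *\<^sub>C y" by (rule scaleC_add_right)
  show "(r *\<^sub>R c) *\<^sub>C x = r *\<^sub>R c *\<^sub>C x"
    by (simp add: scaleR_conv_of_real scaleC_scaleC flip: scaleC_of_real)
  show "c *\<^sub>C r *\<^sub>R x = r *\<^sub>R c *\<^sub>C x"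
    by (simp add: scaleC_scaleC mult.commute flip: scaleC_of_real)
  show "\<exists>K. \<forall>a (b::'a). norm (a *\<^sub>C b) \<le> norm a * norm b * K"
    by (intro exI[of _ 1]) (simp add: norm_scaleC)
qed

interpretation scaleC: bounded_bilinear
    "(*\<^sub>C) :: complex \<Rightarrow> 'a \<Rightarrow> 'a::complex_normed_vector"
  by (rule bounded_bilinear_scaleC)

section \<open>The Banach algebra of bounded complex-linear operators\<close>

text \<open>The norm is the operator norm inherited from \<^typ>\<open>'a \<Rightarrow>\<^sub>L 'a\<close>. The type is not made an
  instance of \<^class>\<open>real_normed_algebra_1\<close>, because this would exclude the zero space.\<close>

typedef (overloaded) 'a bop = "{T :: 'a::complex_normed_vector \<Rightarrow>\<^sub>L 'a. \<forall>c x. T (c *\<^sub>C x) = c *\<^sub>C T x}"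
  morphisms blinfun_of_bop Bop
  by (rule exI[of _ 0]) (simp add: scaleC.zero_right)

setup_lifting type_definition_bop

lift_definition bop_apply :: "'a::complex_normed_vector bop \<Rightarrow> 'a \<Rightarrow> 'a" is blinfun_apply .

lemma bop_eqI: "(\<And>x. bop_apply S x = bop_apply T x) \<Longrightarrow> S = T"
  by transfer (rule blinfun_eqI)

instantiation bop :: (complex_normed_vector) complex_normed_vector
begin

lift_definition norm_bop :: "'a bop \<Rightarrow> real" is norm .

lift_definition zero_bop :: "'a bop" is 0
  by (simp add: scaleC.zero_right)

lift_definition plus_bop :: "'a bop \<Rightarrow> 'a bop \<Rightarrow> 'a bop" is "(+)"
  by (simp add: blinfun.bilinear_simps scaleC.add_right)

lift_definition minus_bop :: "'a bop \<Rightarrow> 'a bop \<Rightarrow> 'a bop" is "(-)"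
  by (simp add: blinfun.bilinear_simps scaleC.diff_right)

lift_definition uminus_bop :: "'a bop \<Rightarrow> 'a bop" is uminus
  by (simp add: blinfun.bilinear_simps scaleC.minus_right)

lift_definition scaleR_bop :: "real \<Rightarrow> 'a bop \<Rightarrow> 'a bop" is "(*\<^sub>R)"
  by (simp add: blinfun.bilinear_simps scaleC.scaleR_right)

lift_definition scaleC_bop :: "complex \<Rightarrow> 'a bop \<Rightarrow> 'a bop"
  is "\<lambda>c T. blinfun_compose (Blinfun ((*\<^sub>C) c)) T"
  by (simp add: bounded_linear_Blinfun_apply scaleC.bounded_linear_right scaleC_scaleC mult.commute)

definition dist_bop :: "'a bop \<Rightarrow> 'a bop \<Rightarrow> real"
  where "dist_bop S T = norm (S - T)"

definition sgn_bop :: "'a bop \<Rightarrow> 'a bop"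
  where "sgn_bop T = inverse (norm T) *\<^sub>R T"

definition uniformity_bop :: "('a bop \<times> 'a bop) filter"
  where "uniformity_bop = (INF e\<in>{0<..}. principal {(S, T). dist S T < e})"

definition open_bop :: "'a bop set \<Rightarrow> bool"
  where "open_bop U = (\<forall>S\<in>U. \<forall>\<^sub>F (S', T) in uniformity. S' = S \<longrightarrow> T \<in> U)"

instance
proof
  fix S T U :: "'a bop" and c d :: complex and r s :: real
  show "S + T + U = S + (T + U)" by transfer simp
  show "S + T = T + S" by transfer simp
  show "0 + S = S" by transfer simp
  show "- S + S = 0" by transfer simp
  show "S - T = S + - T" by transfer simp
  show "r *\<^sub>R (S + T) = r *\<^sub>R S + r *\<^sub>R T" by transfer (simp add: algebra_simps)
  show "(r + s) *\<^sub>R S = r *\<^sub>R S + s *\<^sub>R S" by transfer (simp add: algebra_simps)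
  show "r *\<^sub>R s *\<^sub>R S = (r * s) *\<^sub>R S" by transfer simp
  show "1 *\<^sub>R S = S" by transfer simp
  show "dist S T = norm (S - T)" by (rule dist_bop_def)
  show "sgn S = inverse (norm S) *\<^sub>R S" by (rule sgn_bop_def)
  show "uniformity = (INF e\<in>{0<..}. principal {(S::'a bop, T). dist S T < e})"
    by (rule uniformity_bop_def)
  show "open V = (\<forall>S\<in>V. \<forall>\<^sub>F (S', T) in uniformity. S' = S \<longrightarrow> T \<in> V)" for V :: "'a bop set"
    by (rule open_bop_def)
  show "(norm S = 0) = (S = 0)" by transfer simp
  show "norm (S + T) \<le> norm S + norm T" by transfer (rule norm_triangle_ineq)
  show "norm (r *\<^sub>R S) = \<bar>r\<bar> * norm S" by transfer simp
  note * = bounded_linear_Blinfun_apply scaleC.bounded_linear_right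
  show "c *\<^sub>C (S + T) = c *\<^sub>C S + c *\<^sub>C T"
    by transfer (rule blinfun_eqI, simp add: * blinfun.bilinear_simps scaleC.add_right)
  show "(c + d) *\<^sub>C S = c *\<^sub>C S + d *\<^sub>C S"
    by transfer (rule blinfun_eqI, simp add: * blinfun.bilinear_simps scaleC.add_left)
  show "c *\<^sub>C d *\<^sub>C S = (c * d) *\<^sub>C S"
    by transfer (rule blinfun_eqI, simp add: * scaleC_scaleC)
  show "complex_of_real r *\<^sub>C S = r *\<^sub>R S"
    by transfer (rule blinfun_eqI, simp add: * scaleC_of_real blinfun.bilinear_simps)
  show "norm (c *\<^sub>C S) = cmod c * norm S"
  proof transfer
    fix c :: complex and S :: "'a \<Rightarrow>\<^sub>L 'a"
    have "blinfun_apply (blinfun_compose (Blinfun ((*\<^sub>C) c)) S) = (\<lambda>x. c *\<^sub>C S x)"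
      by (simp add: fun_eq_iff *)
    then have eq: "norm (blinfun_compose (Blinfun ((*\<^sub>C) c)) S) = onorm (\<lambda>x. c *\<^sub>C S x)"
      by (simp add: norm_blinfun.rep_eq)
    have "onorm (\<lambda>x. c *\<^sub>C S x) = cmod c * norm S"
    proof -
      have "(\<lambda>x. norm (c *\<^sub>C S x) / norm x) = (\<lambda>x. norm ((cmod c *\<^sub>R S) x) / norm x)"
        by (simp add: norm_scaleC blinfun.bilinear_simps)
      then have "onorm (\<lambda>x. c *\<^sub>C S x) = norm (cmod c *\<^sub>R S)"
        by (simp only: norm_blinfun.rep_eq onorm_def)
      also have "\<dots> = cmod c * norm S" by simp
      finally show ?thesis .
    qed
    with eq show "norm (blinfun_compose (Blinfun ((*\<^sub>C) c)) S) = cmod c * norm S" by simp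
  qed
qed

end

instance bop :: (complex_banach) complex_banach
proof
  fix X :: "nat \<Rightarrow> 'a bop"
  assume "Cauchy X"
  have d: "dist (blinfun_of_bop S) (blinfun_of_bop T) = dist S T" for S T :: "'a bop"
    unfolding dist_norm by transfer simp
  from \<open>Cauchy X\<close> have "Cauchy (\<lambda>n. blinfun_of_bop (X n))"
    by (simp add: Cauchy_def d)
  then obtain L where L: "(\<lambda>n. blinfun_of_bop (X n)) \<longlonglongrightarrow> L"
    by (auto simp: Cauchy_convergent_iff convergent_def)
  have "L (c *\<^sub>C x) = c *\<^sub>C L x" for c x
  proof (rule LIMSEQ_unique)
    show "(\<lambda>n. blinfun_of_bop (X n) (c *\<^sub>C x)) \<longlonglongrightarrow> L (c *\<^sub>C x)"
      by (intro tendsto_intros L)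
    have "blinfun_of_bop (X n) (c *\<^sub>C x) = c *\<^sub>C blinfun_of_bop (X n) x" for n
      using blinfun_of_bop[of "X n"] by simp
    then show "(\<lambda>n. blinfun_of_bop (X n) (c *\<^sub>C x)) \<longlonglongrightarrow> c *\<^sub>C L x"
      by (simp only:) (intro scaleC.tendsto tendsto_intros L)
  qed
  then have "L = blinfun_of_bop (Bop L)"
    by (simp add: Bop_inverse)
  with L have "(\<lambda>n. blinfun_of_bop (X n)) \<longlonglongrightarrow> blinfun_of_bop (Bop L)" by simp
  then have "X \<longlonglongrightarrow> Bop L"
    by (simp add: tendsto_iff d)
  then show "convergent X" by (auto simp: convergent_def)
qed

instantiation bop :: (complex_normed_vector) "{real_normed_algebra, monoid_mult}"
begin

lift_definition one_bop :: "'a bop" is id_blinfun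
  by simp

lift_definition times_bop :: "'a bop \<Rightarrow> 'a bop \<Rightarrow> 'a bop" is blinfun_compose
  by simp

instance
proof
  fix S T U :: "'a bop" and r :: real
  show "S * T * U = S * (T * U)" by transfer (rule blinfun_eqI, simp)
  show "1 * S = S" "S * 1 = S" by (transfer, rule blinfun_eqI, simp)+
  show "(S + T) * U = S * U + T * U" "S * (T + U) = S * T + S * U"
    "r *\<^sub>R S * T = r *\<^sub>R (S * T)" "S * r *\<^sub>R T = r *\<^sub>R (S * T)"
    by (transfer, rule blinfun_eqI, simp add: blinfun.bilinear_simps)+
  show "norm (S * T) \<le> norm S * norm T" by transfer (rule norm_blinfun_compose)
qed

end

lemma bop_apply_simps [simp]:
  "bop_apply 0 x = 0"
  "bop_apply 1 x = x"
  "bop_apply (S + T) x = bop_apply S x + bop_apply T x"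
  "bop_apply (S - T) x = bop_apply S x - bop_apply T x"
  "bop_apply (- S) x = - bop_apply S x"
  "bop_apply (S * T) x = bop_apply S (bop_apply T x)"
  "bop_apply (r *\<^sub>R S) x = r *\<^sub>R bop_apply S x"
  "bop_apply (c *\<^sub>C S) x = c *\<^sub>C bop_apply S x"
  "bop_apply S (c *\<^sub>C x) = c *\<^sub>C bop_apply S x"
  by (transfer; simp add: blinfun.bilinear_simps bounded_linear_Blinfun_apply
      scaleC.bounded_linear_right)+

lemma scaleC_mult_bop:
  fixes S T :: "'a::complex_normed_vector bop"
  shows "(c *\<^sub>C S) * T = c *\<^sub>C (S * T)" "S * (c *\<^sub>C T) = c *\<^sub>C (S * T)"
  by (rule bop_eqI, simp)+

definition resolvent_set :: "'a::complex_normed_vector bop \<Rightarrow> complex set"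
  where "resolvent_set A = {z. \<exists>B. (z *\<^sub>C 1 - A) * B = 1 \<and> B * (z *\<^sub>C 1 - A) = 1}"

definition resolvent :: "'a::complex_normed_vector bop \<Rightarrow> complex \<Rightarrow> 'a bop"
  where "resolvent A z = (THE B. (z *\<^sub>C 1 - A) * B = 1 \<and> B * (z *\<^sub>C 1 - A) = 1)"

section \<open>Test functions on the complex plane\<close>

definition pderiv_x :: "(complex \<Rightarrow> complex) \<Rightarrow> complex \<Rightarrow> complex"
  where "pderiv_x f z = frechet_derivative f (at z) 1"

definition pderiv_y :: "(complex \<Rightarrow> complex) \<Rightarrow> complex \<Rightarrow> complex"
  where "pderiv_y f z = frechet_derivative f (at z) \<i>"

text \<open>Differentiability of functions on \<^typ>\<open>complex\<close> always means real differentiability here.\<close>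

primrec C_fun :: "nat \<Rightarrow> (complex \<Rightarrow> complex) \<Rightarrow> bool"
  where
    "C_fun 0 f \<longleftrightarrow> continuous_on UNIV f"
  | "C_fun (Suc k) f \<longleftrightarrow>
      (\<forall>z. f differentiable at z) \<and> C_fun k (pderiv_x f) \<and> C_fun k (pderiv_y f)"

definition fun_support :: "(complex \<Rightarrow> complex) \<Rightarrow> complex set"
  where "fun_support f = closure {z. f z \<noteq> 0}"

definition test_funs :: "(complex \<Rightarrow> complex) set"
  where "test_funs = {\<phi>. (\<forall>k. C_fun k \<phi>) \<and> compact (fun_support \<phi>)}"

definition dbar :: "(complex \<Rightarrow> complex) \<Rightarrow> complex \<Rightarrow> complex"
  where "dbar \<phi> z = (pderiv_x \<phi> z + \<i> * pderiv_y \<phi> z) / 2"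

definition test_converges :: "(nat \<Rightarrow> complex \<Rightarrow> complex) \<Rightarrow> (complex \<Rightarrow> complex) \<Rightarrow> bool"
  where "test_converges \<Phi> \<phi> \<longleftrightarrow>
    (\<exists>K. compact K \<and> (\<forall>n. fun_support (\<Phi> n) \<subseteq> K)) \<and>
    (\<forall>j k. uniform_limit UNIV (\<lambda>n. (pderiv_x ^^ j) ((pderiv_y ^^ k) (\<Phi> n)))
                              ((pderiv_x ^^ j) ((pderiv_y ^^ k) \<phi>)) sequentially)"

section \<open>Operator-valued distributions\<close>

text \<open>A distribution is represented by a total function, of which only the values on
  \<^const>\<open>test_funs\<close> are relevant. For linear maps on the inductive limit of the
  spaces of test functions supported in a fixed compact set, which are metrizable, continuity
  is sequential continuity.\<close>

definition distribution :: "((complex \<Rightarrow> complex) \<Rightarrow> 'a::complex_normed_vector bop) \<Rightarrow> bool"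
  where "distribution T \<longleftrightarrow>
    (\<forall>\<phi>\<in>test_funs. \<forall>\<psi>\<in>test_funs. T (\<lambda>z. \<phi> z + \<psi> z) = T \<phi> + T \<psi>) \<and>
    (\<forall>c. \<forall>\<phi>\<in>test_funs. T (\<lambda>z. c * \<phi> z) = c *\<^sub>C T \<phi>) \<and>
    (\<forall>\<Phi> \<phi>. (\<forall>n. \<Phi> n \<in> test_funs) \<longrightarrow> \<phi> \<in> test_funs \<longrightarrow> test_converges \<Phi> \<phi> \<longrightarrow>
        (\<lambda>n. T (\<Phi> n)) \<longlonglongrightarrow> T \<phi>)"

definition dist_dbar ::
    "((complex \<Rightarrow> complex) \<Rightarrow> 'a::complex_normed_vector bop) \<Rightarrow> (complex \<Rightarrow> complex) \<Rightarrow> 'a bop"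
  where "dist_dbar T \<phi> = - T (dbar \<phi>)"

definition dist_support ::
    "((complex \<Rightarrow> complex) \<Rightarrow> 'a::complex_normed_vector bop) \<Rightarrow> complex set"
  where "dist_support T =
    - \<Union>{U. open U \<and> (\<forall>\<phi>\<in>test_funs. fun_support \<phi> \<subseteq> U \<longrightarrow> T \<phi> = 0)}"

section \<open>Resolvent distributions\<close>

text \<open>The integral of \<open>R(z\<^sub>1) \<phi>\<^sub>1(z\<^sub>1) \<integral> \<phi>\<^sub>2(z\<^sub>2) / (z\<^sub>2 - z\<^sub>1)\<close> over \<open>z\<^sub>1\<close> is the value of \<open>R\<close> at the
  test function that multiplies \<open>R\<close> there. Note that the denominator is \<open>z\<^sub>2 - z\<^sub>1\<close> in both terms.\<close>

definition resolvent_distribution ::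
    "((complex \<Rightarrow> complex) \<Rightarrow> 'a::complex_normed_vector bop) \<Rightarrow> bool"
  where "resolvent_distribution R \<longleftrightarrow> distribution R \<and>
    (\<forall>\<phi>\<^sub>1\<in>test_funs. \<forall>\<phi>\<^sub>2\<in>test_funs.
      R \<phi>\<^sub>1 * R \<phi>\<^sub>2 =
        R (\<lambda>z\<^sub>1. \<phi>\<^sub>1 z\<^sub>1 * (LINT z\<^sub>2|lborel. \<phi>\<^sub>2 z\<^sub>2 / (z\<^sub>2 - z\<^sub>1))) -
        R (\<lambda>z\<^sub>2. \<phi>\<^sub>2 z\<^sub>2 * (LINT z\<^sub>1|lborel. \<phi>\<^sub>1 z\<^sub>1 / (z\<^sub>2 - z\<^sub>1))))"

definition spectral_distribution ::
    "((complex \<Rightarrow> complex) \<Rightarrow> 'a::complex_normed_vector bop) \<Rightarrow> (complex \<Rightarrow> complex) \<Rightarrow> 'a bop"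
  where "spectral_distribution R \<phi> = (1 / pi) *\<^sub>R dist_dbar R \<phi>"

text \<open>The operator-valued integral is the gauge integral, since the Bochner integral of the library
  is restricted to second countable spaces. The integrand is continuous with compact support:
  it vanishes off the support of \<open>\<phi>\<close>, which lies in the open resolvent set.\<close>

definition extends_resolvent ::
    "((complex \<Rightarrow> complex) \<Rightarrow> 'a::complex_normed_vector bop) \<Rightarrow> 'a bop \<Rightarrow> bool"
  where "extends_resolvent R A \<longleftrightarrow>
    (\<forall>\<phi>\<in>test_funs. fun_support \<phi> \<subseteq> resolvent_set A \<longrightarrow>
      R \<phi> = integral UNIV (\<lambda>z. \<phi> z *\<^sub>C resolvent A z))"

section \<open>The value of a compactly supported distribution at the constant function 1\<close>

definition cutoff_funs :: "complex set \<Rightarrow> (complex \<Rightarrow> complex) set"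
  where "cutoff_funs K =
    {\<eta>. \<eta> \<in> test_funs \<and> (\<exists>U. open U \<and> K \<subseteq> U \<and> (\<forall>z\<in>U. \<eta> z = 1))}"

text \<open>\<open>value_at_one T B\<close> says that \<open>T(1)\<close> is defined and equals \<open>B\<close>.\<close>

definition value_at_one ::
    "((complex \<Rightarrow> complex) \<Rightarrow> 'a::complex_normed_vector bop) \<Rightarrow> 'a bop \<Rightarrow> bool"
  where "value_at_one T B \<longleftrightarrow>
    compact (dist_support T) \<and> cutoff_funs (dist_support T) \<noteq> {} \<and>
    (\<forall>\<eta>\<in>cutoff_funs (dist_support T). T \<eta> = B)"

end

theory Submission
  imports Defs
begin

text \<open>For \<open>|z| > \<parallel>A\<parallel>\<close> the distribution \<open>R\<close> is the Neumann series \<open>\<Sum>n. z^(-n-1) A^n\<close>, which is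
  holomorphic, so \<open>M\<close> vanishes there. Therefore \<open>M(1)\<close> is the value of \<open>M\<close> at a radial cutoff
  \<open>\<eta>(z) = h(|z|\<^sup>2)\<close> that is 1 near the disc of radius \<open>\<parallel>A\<parallel>\<close>; its \<open>dbar\<close>-derivative \<open>z h'(|z|\<^sup>2)\<close>
  lives on an annulus where the series converges uniformly. Term by term, the integral of
  \<open>z h'(|z|\<^sup>2) z^(-n-1)\<close> is 0 for \<open>n > 0\<close> and, since \<open>|z|\<^sup>2\<close> maps the Lebesgue measure of the plane to
  \<open>\<pi>\<close> times that of the half-line, \<open>-\<pi>\<close> for \<open>n = 0\<close>. The support of \<open>M\<close> may be smaller than the disc;
  a partition-of-unity argument shows that the choice of the cutoff does not matter.\<close>

section \<open>Smooth functions\<close>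

lemma has_derivative_pderiv:
  assumes "f differentiable at z"
  shows "(f has_derivative (\<lambda>w. of_real (Re w) * pderiv_x f z + of_real (Im w) * pderiv_y f z)) (at z)"
proof -
  let ?D = "frechet_derivative f (at z)"
  have D: "(f has_derivative ?D) (at z)"
    using assms by (simp add: frechet_derivative_works)
  interpret linear ?D
    using D by (rule has_derivative_linear)
  have "?D w = of_real (Re w) * pderiv_x f z + of_real (Im w) * pderiv_y f z" for w
  proof -
    have "w = Re w *\<^sub>R 1 + Im w *\<^sub>R \<i>"
      by (simp add: complex_eq_iff)
    then have "?D w = ?D (Re w *\<^sub>R 1 + Im w *\<^sub>R \<i>)"
      by simp
    then show ?thesis
      by (simp only: add scale pderiv_x_def pderiv_y_def) (simp add: scaleR_conv_of_real)
  qed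
  then have "?D = (\<lambda>w. of_real (Re w) * pderiv_x f z + of_real (Im w) * pderiv_y f z)"
    by (rule ext)
  with D show ?thesis
    by simp
qed

lemma pderiv_eqI:
  assumes "(f has_derivative (\<lambda>w. of_real (Re w) * p + of_real (Im w) * q)) (at z)"
  shows "pderiv_x f z = p" "pderiv_y f z = q"
  by (simp_all add: pderiv_x_def pderiv_y_def flip: frechet_derivative_at[OF assms])

text \<open>A derivative written in this shape identifies both partial derivatives, so a smoothness
  proof only has to exhibit \<open>p\<close> and \<open>q\<close>.\<close>

lemma C_fun_SucI:
  assumes "\<And>z. (f has_derivative (\<lambda>w. of_real (Re w) * p z + of_real (Im w) * q z)) (at z)"
    and "C_fun k p" "C_fun k q"
  shows "C_fun (Suc k) f"
proof -
  have "pderiv_x f = p" "pderiv_y f = q"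
    by (rule ext, rule pderiv_eqI[OF assms(1)])+
  with assms(2,3) show ?thesis
    using differentiableI[OF assms(1)] by simp
qed

lemma C_fun_SucE:
  assumes "C_fun (Suc k) f"
  shows "(f has_derivative (\<lambda>w. of_real (Re w) * pderiv_x f z + of_real (Im w) * pderiv_y f z)) (at z)"
    and "C_fun k (pderiv_x f)" "C_fun k (pderiv_y f)"
  using assms by (simp_all add: has_derivative_pderiv)

lemma C_fun_SucD: "C_fun (Suc k) f \<Longrightarrow> C_fun k f"
proof (induction k arbitrary: f)
  case 0
  then show ?case
    by (simp add: continuous_at_imp_continuous_on differentiable_imp_continuous_within)
next
  case (Suc k)
  note f = Suc.prems[unfolded C_fun.simps(2)[of "Suc k"]]
  show ?case
    unfolding C_fun.simps(2)[of k] by (intro conjI Suc.IH) (use f in blast)+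
qed

lemma C_fun_const: "C_fun k (\<lambda>z. c)"
proof (induction k arbitrary: c)
  case (Suc k)
  show ?case
    by (rule C_fun_SucI[where p="\<lambda>_. 0" and q="\<lambda>_. 0"]) (auto intro: Suc)
qed simp

lemma C_fun_Re: "C_fun k (\<lambda>z. of_real (Re z))"
proof (cases k)
  case (Suc k)
  show ?thesis unfolding Suc
    by (rule C_fun_SucI[where p="\<lambda>_. 1" and q="\<lambda>_. 0"])
       (auto intro: C_fun_const intro!: derivative_eq_intros)
qed (auto intro!: continuous_intros)

lemma C_fun_Im: "C_fun k (\<lambda>z. of_real (Im z))"
proof (cases k)
  case (Suc k)
  show ?thesis unfolding Suc
    by (rule C_fun_SucI[where p="\<lambda>_. 0" and q="\<lambda>_. 1"])
       (auto intro: C_fun_const intro!: derivative_eq_intros)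
qed (auto intro!: continuous_intros)

lemma C_fun_add: "C_fun k f \<Longrightarrow> C_fun k g \<Longrightarrow> C_fun k (\<lambda>z. f z + g z)"
proof (induction k arbitrary: f g)
  case (Suc k)
  show ?case
    by (rule C_fun_SucI[OF _ Suc.IH[OF C_fun_SucE(2)[OF Suc.prems(1)] C_fun_SucE(2)[OF Suc.prems(2)]]
            Suc.IH[OF C_fun_SucE(3)[OF Suc.prems(1)] C_fun_SucE(3)[OF Suc.prems(2)]]])
       (rule has_derivative_eq_rhs[OF has_derivative_add[OF C_fun_SucE(1)[OF Suc.prems(1)]
            C_fun_SucE(1)[OF Suc.prems(2)]]], simp add: algebra_simps)
qed (auto intro!: continuous_intros)

lemma C_fun_mult: "C_fun k f \<Longrightarrow> C_fun k g \<Longrightarrow> C_fun k (\<lambda>z. f z * g z)"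
proof (induction k arbitrary: f g)
  case (Suc k)
  note f = C_fun_SucE[OF Suc.prems(1)] and g = C_fun_SucE[OF Suc.prems(2)]
  \<comment> \<open>The product rule leaves undifferentiated factors, which must be known to be C^k
    as well.\<close>
  note f' = C_fun_SucD[OF Suc.prems(1)] and g' = C_fun_SucD[OF Suc.prems(2)]
  show ?case
    by (rule C_fun_SucI[OF _ C_fun_add[OF Suc.IH[OF f(2) g'] Suc.IH[OF f' g(2)]]
            C_fun_add[OF Suc.IH[OF f(3) g'] Suc.IH[OF f' g(3)]]])
       (rule has_derivative_eq_rhs[OF has_derivative_mult[OF f(1) g(1)]], simp add: algebra_simps)
qed (auto intro!: continuous_intros)

lemma C_fun_cmult: "C_fun k f \<Longrightarrow> C_fun k (\<lambda>z. c * f z)"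
  by (intro C_fun_mult C_fun_const)

lemma C_fun_diff: "C_fun k f \<Longrightarrow> C_fun k g \<Longrightarrow> C_fun k (\<lambda>z. f z - g z)"
  using C_fun_add[of k f "\<lambda>z. (-1) * g z"] C_fun_cmult[of k g "-1"] by simp

section \<open>Smooth cutoffs\<close>

text \<open>C^k on the line. The derivative is an existential witness, so that each induction step
  only names a formula for it.\<close>

primrec C_real :: "nat \<Rightarrow> (real \<Rightarrow> real) \<Rightarrow> bool"
  where
    "C_real 0 f \<longleftrightarrow> continuous_on UNIV f"
  | "C_real (Suc k) f \<longleftrightarrow>
      (\<exists>f'. (\<forall>x. (f has_real_derivative f' x) (at x)) \<and> C_real k f')"

lemma C_real_SucD: "C_real (Suc k) f \<Longrightarrow> C_real k f"
proof (induction k arbitrary: f)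
  case 0
  then show ?case
    by (auto intro!: continuous_at_imp_continuous_on intro: DERIV_isCont)
next
  case (Suc k)
  then show ?case
    unfolding C_real.simps(2)[of k] by (metis C_real.simps(2))
qed

lemma C_real_const: "C_real k (\<lambda>x. c)"
proof (induction k arbitrary: c)
  case (Suc k)
  show ?case
    by (auto intro!: exI[of _ "\<lambda>_. 0"] Suc)
qed simp

lemma C_real_add: "C_real k f \<Longrightarrow> C_real k g \<Longrightarrow> C_real k (\<lambda>x. f x + g x)"
proof (induction k arbitrary: f g)
  case (Suc k)
  then obtain f' g' where
    "\<And>x. (f has_real_derivative f' x) (at x)" "C_real k f'"
    "\<And>x. (g has_real_derivative g' x) (at x)" "C_real k g'"
    by auto
  then show ?case
    by (auto intro!: exI[of _ "\<lambda>x. f' x + g' x"] Suc.IH DERIV_add)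
qed (auto intro!: continuous_intros)

lemma C_real_mult: "C_real k f \<Longrightarrow> C_real k g \<Longrightarrow> C_real k (\<lambda>x. f x * g x)"
proof (induction k arbitrary: f g)
  case (Suc k)
  note f0 = C_real_SucD[OF Suc.prems(1)] and g0 = C_real_SucD[OF Suc.prems(2)]
  from Suc.prems obtain f' g' where *:
    "\<And>x. (f has_real_derivative f' x) (at x)" "C_real k f'"
    "\<And>x. (g has_real_derivative g' x) (at x)" "C_real k g'"
    by auto
  have "C_real k (\<lambda>x. f' x * g x + g' x * f x)"
    by (intro C_real_add Suc.IH f0 g0 *)
  with * show ?case
    by (auto intro!: exI[of _ "\<lambda>x. f' x * g x + g' x * f x"] DERIV_mult)
qed (auto intro!: continuous_intros)

lemma C_real_affine: "C_real k f \<Longrightarrow> C_real k (\<lambda>x. f (c * x + d))"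
proof (induction k arbitrary: f)
  case 0
  then show ?case
    unfolding C_real.simps by (rule continuous_on_compose2) (auto intro!: continuous_intros)
next
  case (Suc k)
  then obtain f' where *:
    "\<And>x. (f has_real_derivative f' x) (at x)" "C_real k f'"
    by auto
  have "((\<lambda>x. f (c * x + d)) has_real_derivative f' (c * x + d) * c) (at x)" for x
    by (auto intro!: derivative_eq_intros DERIV_chain2[OF *(1)])
  moreover have "C_real k (\<lambda>x. f' (c * x + d) * c)"
    by (intro C_real_mult C_real_const Suc.IH *)
  ultimately show ?case
    unfolding C_real.simps by (intro exI[of _ "\<lambda>x. f' (c * x + d) * c"] conjI allI)
qed

section \<open>The flat function exp(-1/t) and smooth steps\<close>

lemma poly_mult_exp_tendsto_0:
  fixes p :: "real poly"
  shows "((\<lambda>x. poly p x * exp (- x)) \<longlongrightarrow> 0) at_top"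
proof -
  have "((\<lambda>x. \<Sum>i\<le>degree p. coeff p i * (x ^ i / exp x)) \<longlongrightarrow> (\<Sum>i\<le>degree p. coeff p i * 0)) at_top"
    by (intro tendsto_intros tendsto_power_div_exp_0)
  then show ?thesis
    by (simp add: poly_altdef exp_minus sum_distrib_right divide_inverse mult.assoc)
qed

text \<open>The classical exp(-1/t), extended by 0, with a polynomial factor in 1/t. This factor
  makes the family closed under differentiation, so smoothness follows by an induction over all
  \<open>p\<close> at once.\<close>

definition flat_exp :: "real poly \<Rightarrow> real \<Rightarrow> real"
  where "flat_exp p t = (if t > 0 then poly p (inverse t) * exp (- inverse t) else 0)"

lemma flat_exp_tendsto_0: "((\<lambda>t. flat_exp p t) \<longlongrightarrow> 0) (at 0)"
proof -
  have "((\<lambda>t. flat_exp p t) \<longlongrightarrow> 0) (at_right 0)"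
  proof (rule Lim_transform_eventually)
    show "((\<lambda>t. poly p (inverse t) * exp (- inverse t)) \<longlongrightarrow> 0) (at_right 0)"
      by (rule filterlim_compose[OF poly_mult_exp_tendsto_0 filterlim_inverse_at_top_right])
    show "\<forall>\<^sub>F t in at_right 0. poly p (inverse t) * exp (- inverse t) = flat_exp p t"
      by (auto simp: flat_exp_def eventually_at_filter)
  qed
  moreover have "((\<lambda>t. flat_exp p t) \<longlongrightarrow> 0) (at_left 0)"
    by (rule tendsto_eventually) (auto simp: flat_exp_def eventually_at_filter)
  ultimately show ?thesis
    by (simp add: filterlim_at_split)
qed

text \<open>For t > 0 put x = 1/t: then dx/dt = -x^2, and p(x) exp(-x) has x-derivative (p' - p)(x)
  exp(-x). The point 0 needs the decay of the whole family.\<close>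

lemma flat_exp_has_derivative:
  "(flat_exp p has_real_derivative flat_exp (monom 1 2 * (p - pderiv p)) t) (at t)"
proof -
  consider "t > 0" | "t < 0" | "t = 0"
    by linarith
  then show ?thesis
  proof cases
    case 1
    have "((\<lambda>t. poly p (inverse t) * exp (- inverse t)) has_real_derivative
        flat_exp (monom 1 2 * (p - pderiv p)) t) (at t)"
      using 1 by (auto intro!: derivative_eq_intros DERIV_chain2[OF poly_DERIV]
          simp: flat_exp_def poly_monom field_simps power2_eq_square)
    then show ?thesis
      by (rule has_field_derivative_transform_within_open[of _ _ _ "{0<..}"])
         (use 1 in \<open>auto simp: flat_exp_def\<close>)
  next
    case 2
    have "((\<lambda>t. 0) has_real_derivative flat_exp (monom 1 2 * (p - pderiv p)) t) (at t)"
      using 2 by (simp add: flat_exp_def)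
    then show ?thesis
      by (rule has_field_derivative_transform_within_open[of _ _ _ "{..<0}"])
         (use 2 in \<open>auto simp: flat_exp_def\<close>)
  next
    case 3
    \<comment> \<open>The difference quotient at 0 is again a member of the family, so its limit is
      already known. Division by 0 gives 0, as does \<open>flat_exp\<close> at 0, so the two
      functions agree even at t = 0.\<close>
    have "(\<lambda>t. (flat_exp p t - flat_exp p 0) / (t - 0)) = flat_exp (monom 1 1 * p)"
      by (auto simp: fun_eq_iff flat_exp_def poly_monom field_simps)
    with 3 flat_exp_tendsto_0[of "monom 1 1 * p"] show ?thesis
      unfolding has_field_derivative_iff by (simp add: flat_exp_def[of _ 0])
  qed
qed

lemma C_real_flat_exp: "C_real k (flat_exp p)"
proof (induction k arbitrary: p)
  case 0
  show ?case
    using flat_exp_has_derivative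
    by (auto intro!: continuous_at_imp_continuous_on intro: DERIV_isCont)
next
  case (Suc k)
  then show ?case
    using flat_exp_has_derivative by auto
qed

lemma smooth_step_exists:
  fixes a b :: real
  assumes "a < b"
  obtains h where "\<And>k. C_real k h" "\<And>s. s \<le> a \<Longrightarrow> h s = 1" "\<And>s. s \<ge> b \<Longrightarrow> h s = 0"
proof -
  \<comment> \<open>Each factor switches off one side, so \<open>u\<close> is positive exactly on
    the open interval from \<open>a\<close> to \<open>b\<close>; a rescaled antiderivative of it is
    the step.\<close>
  define u where "u s = flat_exp 1 (1 * s + - a) * flat_exp 1 (- 1 * s + b)" for s
  have u: "C_real k u" for k
    unfolding u_def by (intro C_real_mult C_real_affine C_real_flat_exp)
  have "continuous_on UNIV u"
    using u[of 0] by simp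
  then have "\<exists>F. \<forall>x. - \<infinity> < ereal x \<longrightarrow> ereal x < \<infinity> \<longrightarrow> (F has_vector_derivative u x) (at x)"
    by (intro einterval_antiderivative) (auto simp: continuous_on_eq_continuous_at)
  then obtain F where F: "\<And>x. (F has_real_derivative u x) (at x)"
    by (auto simp: has_real_derivative_iff_has_vector_derivative)
  have Fc: "F x = F y" if "x \<le> y" "\<And>s. x < s \<Longrightarrow> s < y \<Longrightarrow> u s = 0" for x y
  proof (cases "x = y")
    case False
    have "F y = F x"
    proof (rule DERIV_isconst_end[where f=F])
      show "x < y"
        using False that(1) by simp
      fix s
      assume "x < s" "s < y"
      then show "(F has_real_derivative 0) (at s)"
        using F[of s] that(2)[of s] by simp
    qed (use F in \<open>auto intro!: continuous_at_imp_continuous_on intro: DERIV_isCont\<close>)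
    then show ?thesis ..
  qed simp
  have "F a < F b"
  proof (rule DERIV_pos_imp_increasing_open[where f=F, OF assms])
    show "\<exists>y. (F has_real_derivative y) (at s) \<and> y > 0" if "a < s" "s < b" for s
      using F[of s] that by (intro exI[of _ "u s"]) (simp add: u_def flat_exp_def)
  qed (use F in \<open>auto intro!: continuous_at_imp_continuous_on intro: DERIV_isCont\<close>)
  \<comment> \<open>This is (F b - F s) / (F b - F a), which falls from 1 to 0; the constant stands
    on the right to match \<open>DERIV_cmult_right\<close>.\<close>
  define h where "h s = (F s - F b) * (- 1 / (F b - F a))" for s
  have "C_real k h" for k
  proof -
    have "(h has_real_derivative u s * (- 1 / (F b - F a))) (at s)" for s
      unfolding h_def by (rule DERIV_cmult_right) (rule derivative_eq_intros F refl | simp)+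
    moreover have "C_real k (\<lambda>s. u s * (- 1 / (F b - F a)))"
      by (intro C_real_mult C_real_const u)
    ultimately have "C_real (Suc k) h"
      unfolding C_real.simps by (intro exI[of _ "\<lambda>s. u s * (- 1 / (F b - F a))"] conjI allI)
    then show ?thesis
      by (rule C_real_SucD)
  qed
  moreover have "h s = 1" if "s \<le> a" for s
    using Fc[of s a] that \<open>F a < F b\<close> by (simp add: h_def u_def flat_exp_def field_simps)
  moreover have "h s = 0" if "s \<ge> b" for s
    using Fc[of b s] that by (simp add: h_def u_def flat_exp_def)
  ultimately show thesis
    using that by blast
qed

section \<open>Radial functions on the plane\<close>

lemma has_derivative_radial:
  assumes "(h has_real_derivative h') (at ((cmod (z - c))\<^sup>2))"
  shows "((\<lambda>z. complex_of_real (h ((cmod (z - c))\<^sup>2))) has_derivative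
      (\<lambda>w. of_real (Re w) * of_real (h' * (2 * (Re z - Re c)))
        + of_real (Im w) * of_real (h' * (2 * (Im z - Im c))))) (at z)"
proof -
  have "((\<lambda>z. (cmod (z - c))\<^sup>2) has_derivative
      (\<lambda>w. Re w * (2 * (Re z - Re c)) + Im w * (2 * (Im z - Im c)))) (at z)"
    unfolding cmod_power2 by (auto intro!: derivative_eq_intros simp: fun_eq_iff algebra_simps)
  from has_derivative_compose[OF this assms[unfolded has_field_derivative_def]]
  have "((\<lambda>z. h ((cmod (z - c))\<^sup>2)) has_derivative
      (\<lambda>w. h' * (Re w * (2 * (Re z - Re c)) + Im w * (2 * (Im z - Im c))))) (at z)"
    by simp
  from bounded_linear.has_derivative[OF bounded_linear_of_real[where 'a=complex] this]
  show ?thesis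
    by (simp add: algebra_simps)
qed

text \<open>The squared modulus is a polynomial in the real coordinates, hence smooth at the centre
  too. The partial derivatives are radial functions built from the derivative of \<open>h\<close>,
  times affine ones, which drives the induction.\<close>

lemma C_fun_radial: "C_real k h \<Longrightarrow> C_fun k (\<lambda>z. of_real (h ((cmod (z - c))\<^sup>2)))"
proof (induction k arbitrary: h)
  case 0
  then have "continuous_on UNIV (\<lambda>z. h ((cmod (z - c))\<^sup>2))"
    unfolding C_real.simps by (rule continuous_on_compose2) (auto intro!: continuous_intros)
  then show ?case
    by (auto intro: continuous_on_of_real)
next
  case (Suc k)
  then obtain h' where *: "\<And>x. (h has_real_derivative h' x) (at x)" "C_real k h'"
    by auto
  have "C_fun k (\<lambda>z. of_real (h' ((cmod (z - c))\<^sup>2)) * (2 * (of_real (Re z) - of_real (Re c))))"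
    and "C_fun k (\<lambda>z. of_real (h' ((cmod (z - c))\<^sup>2)) * (2 * (of_real (Im z) - of_real (Im c))))"
    by (intro C_fun_mult C_fun_diff C_fun_const C_fun_Re C_fun_Im Suc.IH *)+
  moreover have "((\<lambda>z. complex_of_real (h ((cmod (z - c))\<^sup>2))) has_derivative
      (\<lambda>w. of_real (Re w) * (of_real (h' ((cmod (z - c))\<^sup>2)) * (2 * (of_real (Re z) - of_real (Re c))))
        + of_real (Im w) * (of_real (h' ((cmod (z - c))\<^sup>2)) * (2 * (of_real (Im z) - of_real (Im c)))))) (at z)" for z
    using has_derivative_radial[OF *(1)] by simp
  ultimately show ?case
    by (intro C_fun_SucI)
qed

section \<open>Test functions and distributions\<close>

lemma fun_support_subset: "closed S \<Longrightarrow> (\<And>z. z \<notin> S \<Longrightarrow> f z = 0) \<Longrightarrow> fun_support f \<subseteq> S"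
  unfolding fun_support_def by (rule closure_minimal) auto

lemma eq_0_outside_fun_support: "z \<notin> fun_support f \<Longrightarrow> f z = 0"
  unfolding fun_support_def using closure_subset[of "{z. f z \<noteq> 0}"] by auto

lemma test_funsI:
  assumes "\<And>k. C_fun k f" "compact S" "\<And>z. z \<notin> S \<Longrightarrow> f z = 0"
  shows "f \<in> test_funs"
proof -
  have "fun_support f \<subseteq> S"
    using assms by (intro fun_support_subset compact_imp_closed)
  moreover have "closed (fun_support f)"
    by (simp add: fun_support_def)
  ultimately have "compact (fun_support f)"
    using assms(2) by (metis compact_Int_closed inf.absorb2)
  with assms(1) show ?thesis
    by (simp add: test_funs_def)
qed

lemma test_funsD:
  assumes "\<phi> \<in> test_funs"
  shows "C_fun k \<phi>" "compact (fun_support \<phi>)"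
  using assms by (simp_all add: test_funs_def)

lemma test_funs_add:
  assumes "\<phi> \<in> test_funs" "\<psi> \<in> test_funs"
  shows "(\<lambda>z. \<phi> z + \<psi> z) \<in> test_funs"
proof (rule test_funsI)
  show "compact (fun_support \<phi> \<union> fun_support \<psi>)"
    using assms by (intro compact_Un test_funsD)
qed (auto intro: C_fun_add test_funsD assms simp: eq_0_outside_fun_support)

lemma test_funs_mult:
  assumes "\<phi> \<in> test_funs" "\<And>k. C_fun k f"
  shows "(\<lambda>z. \<phi> z * f z) \<in> test_funs"
  by (rule test_funsI[of _ "fun_support \<phi>"])
     (auto intro: C_fun_mult test_funsD assms simp: eq_0_outside_fun_support)

lemma test_funs_diff:
  assumes "\<phi> \<in> test_funs" "\<psi> \<in> test_funs"
  shows "(\<lambda>z. \<phi> z - \<psi> z) \<in> test_funs"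
  using test_funs_add[OF assms(1) test_funs_mult[OF assms(2) C_fun_const[of _ "-1"]]] by simp

lemma pderiv_eq_0:
  assumes "open U" "z \<in> U" "\<And>w. w \<in> U \<Longrightarrow> f w = 0"
  shows "pderiv_x f z = 0" "pderiv_y f z = 0"
proof -
  have "((\<lambda>w. 0) has_derivative (\<lambda>w. of_real (Re w) * 0 + of_real (Im w) * 0)) (at z)"
    by simp
  then have "(f has_derivative (\<lambda>w. of_real (Re w) * 0 + of_real (Im w) * 0)) (at z)"
    by (rule has_derivative_transform_within_open[OF _ assms(1,2)]) (simp add: assms(3))
  then show "pderiv_x f z = 0" "pderiv_y f z = 0"
    by (rule pderiv_eqI)+
qed

section \<open>The dbar operator on test functions\<close>

lemma C_fun_dbar:
  assumes "C_fun (Suc k) f"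
  shows "C_fun k (dbar f)"
proof -
  have "C_fun k (\<lambda>z. (1 / 2) * (pderiv_x f z + \<i> * pderiv_y f z))"
    by (intro C_fun_cmult C_fun_add C_fun_SucE[OF assms])
  then show ?thesis
    by (simp add: dbar_def[abs_def])
qed

lemma dbar_eq_0:
  assumes "open U" "z \<in> U" "\<And>w. w \<in> U \<Longrightarrow> f w = 0"
  shows "dbar f z = 0"
  using pderiv_eq_0[OF assms] by (simp add: dbar_def)

lemma dbar_eq_0_outside_fun_support: "z \<notin> fun_support f \<Longrightarrow> dbar f z = 0"
  by (rule dbar_eq_0[of "- fun_support f"]) (auto simp: fun_support_def intro: eq_0_outside_fun_support)

lemma dbar_in_test_funs: "\<phi> \<in> test_funs \<Longrightarrow> dbar \<phi> \<in> test_funs"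
  by (rule test_funsI[OF C_fun_dbar[OF test_funsD(1)] test_funsD(2)])
     (auto intro: dbar_eq_0_outside_fun_support)

lemma fun_support_dbar: "fun_support (dbar f) \<subseteq> fun_support f"
  by (rule fun_support_subset) (simp_all add: fun_support_def[of f] dbar_eq_0_outside_fun_support)

lemma dbar_add:
  assumes "C_fun 1 f" "C_fun 1 g"
  shows "dbar (\<lambda>z. f z + g z) = (\<lambda>z. dbar f z + dbar g z)"
proof
  fix z
  note fg = C_fun_SucE(1)[OF assms(1)[unfolded One_nat_def], of z]
    C_fun_SucE(1)[OF assms(2)[unfolded One_nat_def], of z]
  have *: "((\<lambda>z. f z + g z) has_derivative (\<lambda>w. of_real (Re w) * (pderiv_x f z + pderiv_x g z)
      + of_real (Im w) * (pderiv_y f z + pderiv_y g z))) (at z)"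
    by (rule has_derivative_eq_rhs[OF has_derivative_add[OF fg]]) (simp add: algebra_simps)
  show "dbar (\<lambda>z. f z + g z) z = dbar f z + dbar g z"
    by (simp add: dbar_def pderiv_eqI[OF *] add_divide_distrib distrib_left)
qed

lemma spectral_distribution_add:
  assumes "distribution R" "\<phi> \<in> test_funs" "\<psi> \<in> test_funs"
  shows "spectral_distribution R (\<lambda>z. \<phi> z + \<psi> z)
    = spectral_distribution R \<phi> + spectral_distribution R \<psi>"
proof -
  have "dbar (\<lambda>z. \<phi> z + \<psi> z) = (\<lambda>z. dbar \<phi> z + dbar \<psi> z)"
    by (intro dbar_add test_funsD assms)
  moreover have "R (\<lambda>z. dbar \<phi> z + dbar \<psi> z) = R (dbar \<phi>) + R (dbar \<psi>)"
    using assms dbar_in_test_funs unfolding distribution_def by blast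
  ultimately show ?thesis
    by (simp add: spectral_distribution_def dist_dbar_def algebra_simps)
qed

section \<open>Localization by bump functions\<close>

lemma bump_function_exists:
  fixes c :: complex
  assumes "0 \<le> r" "r < s"
  obtains b where "\<And>k. C_fun k b" "\<And>z. cmod (z - c) \<le> r \<Longrightarrow> b z = 1" "\<And>z. cmod (z - c) \<ge> s \<Longrightarrow> b z = 0"
proof -
  have "r\<^sup>2 < s\<^sup>2"
    using assms by (intro power_strict_mono) auto
  then obtain h where h: "\<And>k. C_real k h" "\<And>t. t \<le> r\<^sup>2 \<Longrightarrow> h t = 1" "\<And>t. t \<ge> s\<^sup>2 \<Longrightarrow> h t = 0"
    by (rule smooth_step_exists) blast
  show thesis
  proof (rule that)
    show "C_fun k (\<lambda>z. of_real (h ((cmod (z - c))\<^sup>2)))" for k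
      by (intro C_fun_radial h)
    show "complex_of_real (h ((cmod (z - c))\<^sup>2)) = 1" if "cmod (z - c) \<le> r" for z
      using that by (simp add: h(2) power_mono)
    show "complex_of_real (h ((cmod (z - c))\<^sup>2)) = 0" if "cmod (z - c) \<ge> s" for z
      using that assms by (simp add: h(3) power_mono)
  qed
qed

text \<open>A partition of unity peeled off one ball at a time: \<open>T\<close> vanishes locally
  near each point of the support of \<open>\<phi>\<close>, and compactness leaves finitely many
  balls, so that additivity suffices to glue.\<close>

lemma eq_0_off_dist_support:
  assumes add: "\<And>\<phi> \<psi>. \<phi> \<in> test_funs \<Longrightarrow> \<psi> \<in> test_funs \<Longrightarrow> T (\<lambda>z. \<phi> z + \<psi> z) = T \<phi> + T \<psi>"
    and \<phi>: "\<phi> \<in> test_funs" "fun_support \<phi> \<inter> dist_support T = {}"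
  shows "T \<phi> = 0"
proof -
  define K where "K = fun_support \<phi>"
  have "\<exists>e>0. \<forall>\<psi>\<in>test_funs. fun_support \<psi> \<subseteq> cball x e \<longrightarrow> T \<psi> = 0" if "x \<in> K" for x
  proof -
    from that \<phi>(2) obtain U where U: "open U" "x \<in> U" "\<forall>\<psi>\<in>test_funs. fun_support \<psi> \<subseteq> U \<longrightarrow> T \<psi> = 0"
      unfolding K_def dist_support_def by blast
    then obtain e where "e > 0" "cball x e \<subseteq> U"
      using open_contains_cball by blast
    with U show ?thesis
      by blast
  qed
  then obtain e where e: "\<And>x. x \<in> K \<Longrightarrow> e x > 0"
    "\<And>x \<psi>. x \<in> K \<Longrightarrow> \<psi> \<in> test_funs \<Longrightarrow> fun_support \<psi> \<subseteq> cball x (e x) \<Longrightarrow> T \<psi> = 0"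
    by metis
  \<comment> \<open>Half radii leave room for a bump that is 1 on the smaller ball and supported in
    the larger one.\<close>
  have "K \<subseteq> (\<Union>x\<in>K. ball x (e x / 2))"
    using e(1) by force
  moreover have "compact K"
    using \<phi>(1) by (simp add: K_def test_funsD)
  ultimately obtain F where F: "F \<subseteq> K" "finite F" "K \<subseteq> (\<Union>x\<in>F. ball x (e x / 2))"
    by (auto elim: compactE_image[where f="\<lambda>x. ball x (e x / 2)" and C=K])
  \<comment> \<open>Induction over the finite cover; only the nonvanishing set has to be covered,
    not its closure.\<close>
  have "T \<psi> = 0" if "\<psi> \<in> test_funs" "{z. \<psi> z \<noteq> 0} \<subseteq> (\<Union>x\<in>F. ball x (e x / 2))" for \<psi>
    using F(2,1) that
  proof (induction F arbitrary: \<psi> rule: finite_induct)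
    case empty
    then have "\<psi> = (\<lambda>z. 0)"
      by auto
    \<comment> \<open>Here T 0 = T 0 + T 0 forces T 0 = 0.\<close>
    with add[OF empty(2,2)] show ?case
      by simp
  next
    case (insert x F)
    then have x: "x \<in> K"
      by simp
    then obtain b where b: "\<And>k. C_fun k b" "\<And>z. cmod (z - x) \<le> e x / 2 \<Longrightarrow> b z = 1"
      "\<And>z. cmod (z - x) \<ge> e x \<Longrightarrow> b z = 0"
      using bump_function_exists[of "e x / 2" "e x" x] e(1)[OF x] by auto
    \<comment> \<open>The first piece is supported in the large ball around \<open>x\<close>; the
      second vanishes on the half ball, so the remaining balls cover it.\<close>
    let ?\<psi>1 = "\<lambda>z. \<psi> z * b z" and ?\<psi>2 = "\<lambda>z. \<psi> z * (1 - b z)"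
    have t: "?\<psi>1 \<in> test_funs" "?\<psi>2 \<in> test_funs"
      by (intro test_funs_mult insert.prems C_fun_diff C_fun_const b)+
    have "T ?\<psi>1 = 0"
      by (rule e(2)[OF x t(1)], rule fun_support_subset) (auto simp: b(3) dist_norm norm_minus_commute)
    moreover have "T ?\<psi>2 = 0"
    proof (rule insert.IH[OF _ t(2)])
      show "{z. \<psi> z * (1 - b z) \<noteq> 0} \<subseteq> (\<Union>x\<in>F. ball x (e x / 2))"
      proof
        fix z
        assume "z \<in> {z. \<psi> z * (1 - b z) \<noteq> 0}"
        then have "\<psi> z \<noteq> 0" "b z \<noteq> 1"
          by auto
        then have "z \<in> (\<Union>x\<in>insert x F. ball x (e x / 2))" "z \<notin> ball x (e x / 2)"
          using insert.prems(3) b(2)[of z] by (auto simp: dist_norm norm_minus_commute)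
        then show "z \<in> (\<Union>x\<in>F. ball x (e x / 2))"
          by blast
      qed
    qed (use insert.prems in simp)
    moreover have "\<psi> = (\<lambda>z. ?\<psi>1 z + ?\<psi>2 z)"
      by (simp add: fun_eq_iff algebra_simps)
    ultimately show ?case
      using add[OF t] by simp
  qed
  moreover have "{z. \<phi> z \<noteq> 0} \<subseteq> (\<Union>x\<in>F. ball x (e x / 2))"
    using F(3) eq_0_outside_fun_support[of _ \<phi>] by (auto simp: K_def)
  ultimately show ?thesis
    using \<phi>(1) by blast
qed

section \<open>Integrals over the plane\<close>

lemma integrable_compact_support:
  fixes f :: "'a::euclidean_space \<Rightarrow> 'b::{banach, second_countable_topology}"
  assumes "continuous_on UNIV f" "compact S" "\<And>x. x \<notin> S \<Longrightarrow> f x = 0"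
  shows "integrable lborel f"
proof -
  have "(\<lambda>x. indicator S x *\<^sub>R f x) = f"
    using assms(3) by (auto simp: fun_eq_iff indicator_def)
  with borel_integrable_compact[OF assms(2) continuous_on_subset[OF assms(1) subset_UNIV]]
  show ?thesis
    by simp
qed

lemma lborel_integral_translation:
  fixes f :: "'a::euclidean_space \<Rightarrow> 'b::{banach, second_countable_topology}"
  assumes "integrable lborel f"
  shows "integrable lborel (\<lambda>x. f (x + a))" "(LINT x|lborel. f (x + a)) = (LINT x|lborel. f x)"
proof -
  have f: "f \<in> borel_measurable borel"
    using assms by simp
  have "integrable (distr lborel borel ((+) a)) f"
    using assms by (simp add: lborel_distr_plus)
  with f show "integrable lborel (\<lambda>x. f (x + a))"
    by (subst (asm) integrable_distr_eq) (auto simp: add.commute)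
  have "(LINT x|lborel. f x) = (LINT x|distr lborel borel ((+) a). f x)"
    by (simp add: lborel_distr_plus)
  also have "\<dots> = (LINT x|lborel. f (a + x))"
    using f by (intro integral_distr) auto
  finally show "(LINT x|lborel. f (x + a)) = (LINT x|lborel. f x)"
    by (simp add: add.commute)
qed

text \<open>By translation invariance all difference quotients integrate to 0.\<close>

lemma integral_directional_derivative_eq_0:
  fixes f :: "'a::euclidean_space \<Rightarrow> 'b::{banach, second_countable_topology}"
  assumes f: "\<And>x. (f has_derivative D x) (at x)"
    and D: "continuous_on UNIV (\<lambda>x. D x v)"
    and S: "compact S" "\<And>x. x \<notin> S \<Longrightarrow> f x = 0"
  shows "(LINT x|lborel. D x v) = 0"
proof -
  have cf: "continuous_on UNIV f"
    using has_derivative_continuous[OF f] by (simp add: continuous_at_imp_continuous_on)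
  then have int_f: "integrable lborel f"
    using S by (rule integrable_compact_support)
  have lin: "D x (t *\<^sub>R v) = t *\<^sub>R D x v" for x t
    using has_derivative_linear[OF f] by (rule linear_scale)
  have D0: "D x v = 0" if "x \<notin> S" for x
  proof -
    have "((\<lambda>x. 0) has_derivative D x) (at x)"
      by (rule has_derivative_transform_within_open[OF f[of x], of "- S"])
         (use that S compact_imp_closed in \<open>auto simp: open_Compl\<close>)
    then have "D x = (\<lambda>x. 0)"
      by (rule has_derivative_unique) (rule has_derivative_const)
    then show ?thesis
      by simp
  qed
  obtain B where B: "\<And>x. norm (D x v) \<le> B" "B \<ge> 0"
  proof -
    have "bounded ((\<lambda>x. D x v) ` S)"
      by (intro compact_imp_bounded compact_continuous_image S continuous_on_subset[OF D]) auto
    then obtain B where "B > 0" "\<And>x. x \<in> S \<Longrightarrow> norm (D x v) \<le> B"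
      by (auto simp: bounded_pos)
    then have "norm (D x v) \<le> B" for x
      using D0[of x] by (cases "x \<in> S") auto
    with that[of B] \<open>B > 0\<close> show ?thesis
      by simp
  qed
  obtain r where r: "\<And>x. x \<in> S \<Longrightarrow> norm x \<le> r"
    using compact_imp_bounded[OF S(1)] by (auto simp: bounded_iff)
  define t where "t n = inverse (real (Suc n))" for n
  have t: "t n > 0" "t n \<le> 1" for n
    by (auto simp: t_def field_simps)
  define g where "g n x = (f (x + t n *\<^sub>R v) - f x) /\<^sub>R t n" for n x
  have "(\<lambda>n. LINT x|lborel. g n x) \<longlonglongrightarrow> (LINT x|lborel. D x v)"
  proof (rule integral_dominated_convergence)
    show "(\<lambda>x. D x v) \<in> borel_measurable lborel"
      using D by (simp add: borel_measurable_continuous_onI)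
    have "continuous_on UNIV (\<lambda>x. f (x + t n *\<^sub>R v))" for n
      by (rule continuous_on_compose2[OF cf]) (auto intro!: continuous_intros)
    then have "continuous_on UNIV (g n)" for n
      unfolding g_def using cf by (intro continuous_intros)
    then show "g n \<in> borel_measurable lborel" for n
      by (simp add: borel_measurable_continuous_onI)
    \<comment> \<open>The majorant of the difference quotients. As \<open>t n \<le> 1\<close>, both
      \<open>x\<close> and \<open>x + t n *\<^sub>R v\<close> miss \<open>S\<close> once norm x > r
      + norm v; inside that ball the mean value inequality gives the bound \<open>B\<close>.\<close>
    show "integrable lborel (\<lambda>x. indicator (cball 0 (r + norm v)) x *\<^sub>R B)"
      by (rule borel_integrable_compact) auto
    show "AE x in lborel. (\<lambda>n. g n x) \<longlonglongrightarrow> D x v"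
    proof (rule AE_I2)
      fix x
      have "((\<lambda>s. x + s *\<^sub>R v) has_derivative (\<lambda>s. s *\<^sub>R v)) (at 0)"
        by (auto intro!: derivative_eq_intros)
      then have "((\<lambda>s. f (x + s *\<^sub>R v)) has_derivative (\<lambda>s. D x (s *\<^sub>R v))) (at 0)"
        by (rule has_derivative_compose) (use f[of x] in simp)
      then have "((\<lambda>s. norm ((f (x + s *\<^sub>R v) - f x) - s *\<^sub>R D x v) / norm s) \<longlongrightarrow> 0) (at 0)"
        by (simp add: has_derivative_iff_norm lin)
      then have "((\<lambda>s. norm ((f (x + s *\<^sub>R v) - f x) /\<^sub>R s - D x v)) \<longlongrightarrow> 0) (at 0)"
      proof (rule Lim_transform_eventually)
        have "norm ((f (x + s *\<^sub>R v) - f x) - s *\<^sub>R D x v) / norm s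
            = norm ((f (x + s *\<^sub>R v) - f x) /\<^sub>R s - D x v)" if "s \<noteq> 0" for s
        proof -
          have "norm ((f (x + s *\<^sub>R v) - f x) /\<^sub>R s - D x v)
              = norm (((f (x + s *\<^sub>R v) - f x) - s *\<^sub>R D x v) /\<^sub>R s)"
            using that by (simp add: algebra_simps)
          also have "\<dots> = norm ((f (x + s *\<^sub>R v) - f x) - s *\<^sub>R D x v) / norm s"
            by (simp add: divide_inverse mult.commute)
          finally show ?thesis ..
        qed
        then show "\<forall>\<^sub>F s in at 0. norm ((f (x + s *\<^sub>R v) - f x) - s *\<^sub>R D x v) / norm s
            = norm ((f (x + s *\<^sub>R v) - f x) /\<^sub>R s - D x v)"
          by (auto simp: eventually_at_filter)
      qed
      then have "((\<lambda>s. (f (x + s *\<^sub>R v) - f x) /\<^sub>R s) \<longlongrightarrow> D x v) (at 0)"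
        by (simp add: tendsto_norm_zero_iff LIM_zero_iff)
      moreover have "filterlim t (at 0) sequentially"
        unfolding t_def filterlim_at by (simp add: LIMSEQ_inverse_real_of_nat del: of_nat_Suc)
      ultimately show "(\<lambda>n. g n x) \<longlonglongrightarrow> D x v"
        unfolding g_def by (rule filterlim_compose)
    qed
    show "AE x in lborel. norm (g n x) \<le> indicator (cball 0 (r + norm v)) x *\<^sub>R B" for n
    proof (rule AE_I2)
      fix x
      show "norm (g n x) \<le> indicator (cball 0 (r + norm v)) x *\<^sub>R B"
      proof (cases "x \<in> cball 0 (r + norm v)")
        case True
        have "norm (f (x + t n *\<^sub>R v) - f (x + 0 *\<^sub>R v)) \<le> B * norm (t n - 0)"
        proof (rule differentiable_bound[OF convex_UNIV])
          show "((\<lambda>s. f (x + s *\<^sub>R v)) has_derivative (\<lambda>u. u *\<^sub>R D (x + s *\<^sub>R v) v))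
              (at s within UNIV)" for s
          proof -
            have "((\<lambda>s. x + s *\<^sub>R v) has_derivative (\<lambda>s. s *\<^sub>R v)) (at s)"
              by (auto intro!: derivative_eq_intros)
            from has_derivative_compose[OF this f[of "x + s *\<^sub>R v"]] show ?thesis
              by (simp add: lin)
          qed
          show "onorm (\<lambda>u. u *\<^sub>R D (x + s *\<^sub>R v) v) \<le> B" for s
            by (rule onorm_le) (use mult_left_mono[OF B(1) abs_ge_zero] in \<open>simp add: mult.commute\<close>)
        qed auto
        moreover have "norm (g n x) = norm (f (x + t n *\<^sub>R v) - f x) / t n"
          using t[of n] by (simp add: g_def divide_inverse mult.commute)
        ultimately show ?thesis
          using True t[of n] by (simp add: pos_divide_le_eq)
      next
        case False
        have "norm (t n *\<^sub>R v) \<le> norm v"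
          using t[of n] by (simp add: mult_left_le_one_le)
        moreover have "norm x \<le> norm (x + t n *\<^sub>R v) + norm (t n *\<^sub>R v)"
          using norm_triangle_ineq4[of "x + t n *\<^sub>R v" "t n *\<^sub>R v"] by simp
        moreover have "norm x > r + norm v"
          using False by simp
        ultimately have "\<not> norm x \<le> r" "\<not> norm (x + t n *\<^sub>R v) \<le> r"
          using norm_ge_zero[of v] by linarith+
        then have "x \<notin> S" "x + t n *\<^sub>R v \<notin> S"
          using r by blast+
        then show ?thesis
          using S(2) B(2) by (simp add: g_def)
      qed
    qed
  qed
  moreover have "(LINT x|lborel. g n x) = 0" for n
    unfolding g_def using int_f lborel_integral_translation[OF int_f, of "t n *\<^sub>R v"] by simp
  ultimately show ?thesis
    by (simp add: LIMSEQ_const_iff)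
qed

text \<open>The sign makes the half-lines \<open>{x<..}\<close> have finite measure.\<close>

lemma distr_neg_cmod_square:
  "distr lborel borel (\<lambda>z. - (cmod z)\<^sup>2) = density lborel (\<lambda>s. ennreal (pi * indicator {..<0} s))"
    (is "?M = ?N")
proof (rule measure_eqI_lessThan)
  \<comment> \<open>The preimage is an open disc, empty for x \<ge> 0. Its area is linear in the
    squared radius, which is why the density is constant on the negative half-line.\<close>
  have M: "emeasure ?M {x<..} = ennreal (pi * max 0 (- x))" for x
  proof -
    have "emeasure ?M {x<..} = emeasure lborel {z. x < - (cmod z)\<^sup>2}"
      by (subst emeasure_distr) (auto simp: vimage_def)
    also have "{z. x < - (cmod z)\<^sup>2} = ball 0 (sqrt (max 0 (- x)))"
    proof (cases "x < 0")
      case True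
      have "x < - (cmod z)\<^sup>2 \<longleftrightarrow> cmod z < sqrt (- x)" for z
        using real_sqrt_less_iff[of "(cmod z)\<^sup>2" "- x"] by (simp add: less_minus_iff)
      moreover have "max 0 (- x) = - x"
        using True by simp
      ultimately show ?thesis
        by (simp add: ball_def)
    next
      case False
      then have "\<not> x < - (cmod z)\<^sup>2" for z
        using zero_le_power2[of "cmod z"] by linarith
      with False show ?thesis
        by auto
    qed
    also have "emeasure lborel (ball (0::complex) (sqrt (max 0 (- x)))) = ennreal (pi * max 0 (- x))"
      by (simp add: emeasure_ball unit_ball_vol_2)
    finally show ?thesis .
  qed
  then show "emeasure ?M {x<..} < \<infinity>" for x
    by simp
  show "emeasure ?M {x<..} = emeasure ?N {x<..}" for x
  proof -
    have "emeasure ?N {x<..} = (\<integral>\<^sup>+ s. ennreal (pi * indicator {..<0} s) * indicator {x<..} s \<partial>lborel)"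
      by (rule emeasure_density) auto
    also have "\<dots> = (\<integral>\<^sup>+ s. ennreal pi * indicator {x<..<0} s \<partial>lborel)"
      by (rule nn_integral_cong) (auto simp: indicator_def)
    also have "\<dots> = ennreal pi * emeasure lborel {x<..<0}"
      by (rule nn_integral_cmult_indicator) simp
    also have "\<dots> = ennreal (pi * max 0 (- x))"
    proof -
      have "emeasure lborel {x<..<0} = ennreal (max 0 (- x))"
        by (cases "x \<le> 0") (auto simp: max_def)
      then show ?thesis
        by (simp add: ennreal_mult)
    qed
    finally show ?thesis
      using M by simp
  qed
qed simp_all

text \<open>The push-forward under -|z|^2 turns the plane integral into pi times an integral over a
  half-line, and the fundamental theorem of calculus evaluates it.\<close>

lemma integral_radial_derivative:
  assumes h: "\<And>s. (h has_real_derivative h' s) (at s)" "continuous_on UNIV h'"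
    and "b \<ge> 0" "\<And>s. s \<le> 0 \<Longrightarrow> h' s = 0" "\<And>s. s \<ge> b \<Longrightarrow> h' s = 0"
  shows "(LINT z|lborel. complex_of_real (h' ((cmod z)\<^sup>2))) = of_real (pi * (h b - h 0))"
proof -
  have c: "continuous_on UNIV (\<lambda>s. h' (- s))"
    by (rule continuous_on_compose2[OF h(2)]) (auto intro!: continuous_intros)
  then have m: "(\<lambda>s. h' (- s)) \<in> borel_measurable borel"
    by (rule borel_measurable_continuous_onI)
  have "(LINT z|lborel. h' ((cmod z)\<^sup>2))
      = (LINT s|distr lborel borel (\<lambda>z. - (cmod z)\<^sup>2). h' (- s))"
    by (subst integral_distr) (use m in auto)
  also have "\<dots> = (LINT s|lborel. (pi * indicator {..<0} s) *\<^sub>R h' (- s))"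
    unfolding distr_neg_cmod_square by (subst integral_density) (use m in auto)
  \<comment> \<open>The fundamental theorem is applied on a compact interval; including the endpoint
    0 is harmless because \<open>h' 0 = 0\<close>.\<close>
  also have "\<dots> = (LINT s|lborel. pi * (indicator {-b..0} s *\<^sub>R h' (- s)))"
    using assms(4,5) by (intro Bochner_Integration.integral_cong) (auto simp: indicator_def)
  also have "\<dots> = pi * (LINT s|lborel. indicator {-b..0} s *\<^sub>R h' (- s))"
    by simp
  also have "(LINT s|lborel. indicator {-b..0} s *\<^sub>R h' (- s)) = (- h (- 0)) - (- h (- (- b)))"
  proof (rule integral_FTC_atLeastAtMost)
    have "((\<lambda>s. - h (- s)) has_real_derivative h' (- s)) (at s)" for s
      using DERIV_minus[OF DERIV_chain2[OF h(1) DERIV_minus[OF DERIV_ident]]] by simp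
    then show "((\<lambda>s. - h (- s)) has_vector_derivative h' (- s)) (at s within {-b..0})" for s
      by (simp add: has_real_derivative_iff_has_vector_derivative has_vector_derivative_at_within)
  qed (use assms c in \<open>auto intro: continuous_on_subset\<close>)
  finally show ?thesis
    by (simp add: integral_complex_of_real)
qed

section \<open>Integration by parts against negative powers of z\<close>

lemma continuous_times_inverse_power:
  fixes f :: "complex \<Rightarrow> complex"
  assumes "continuous_on UNIV f" "r > 0" "\<And>z. cmod z < r \<Longrightarrow> f z = 0"
  shows "continuous_on UNIV (\<lambda>z. f z * inverse z ^ n)"
proof -
  \<comment> \<open>Two open sets cover the plane: on the disc the product is 0, and off the origin
    z^(-n) is continuous.\<close>
  have "continuous_on (ball 0 r \<union> - {0}) (\<lambda>z. f z * inverse z ^ n)"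
  proof (rule continuous_on_open_Un)
    have "continuous_on (ball (0::complex) r) (\<lambda>z. 0 :: complex)"
      by simp
    then show "continuous_on (ball 0 r) (\<lambda>z. f z * inverse z ^ n)"
      by (rule continuous_on_eq) (simp add: assms(3))
    show "continuous_on (- {0}) (\<lambda>z. f z * inverse z ^ n)"
      by (intro continuous_intros continuous_on_subset[OF assms(1)]) auto
  qed auto
  moreover have "ball 0 r \<union> - {0} = (UNIV :: complex set)"
    using \<open>r > 0\<close> by auto
  ultimately show ?thesis
    by simp
qed

lemma has_derivative_times_inverse_power:
  assumes "C_fun 1 f" "r > 0" "\<And>z. cmod z < r \<Longrightarrow> f z = 0"
  shows "((\<lambda>z. f z * inverse z ^ n) has_derivative
    (\<lambda>w. f z * (- of_nat n * inverse z ^ (n + 1) * w)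
      + (of_real (Re w) * pderiv_x f z + of_real (Im w) * pderiv_y f z) * inverse z ^ n)) (at z)"
proof (cases "z = 0")
  case True
  have "pderiv_x f z = 0" "pderiv_y f z = 0" "f z = 0"
    using pderiv_eq_0[of "ball 0 r" z f] assms True by auto
  moreover have "((\<lambda>z. f z * inverse z ^ n) has_derivative (\<lambda>w. 0)) (at z)"
    using True assms(2,3)
    by (intro has_derivative_transform_within_open[OF has_derivative_const, of "ball 0 r"]) auto
  ultimately show ?thesis
    by simp
next
  case False
  \<comment> \<open>For n = 0 the exponent \<open>n - Suc 0\<close> is truncated, but the factor
    \<open>of_nat n\<close> makes both sides 0.\<close>
  have "of_nat n * (- (inverse z ^ Suc (Suc 0)) * inverse z ^ (n - Suc 0)) = - of_nat n * inverse z ^ (n + 1)"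
    by (cases n) (auto simp: algebra_simps)
  then have "((\<lambda>z. inverse z ^ n) has_field_derivative (- of_nat n * inverse z ^ (n + 1))) (at z)"
    by (rule DERIV_cong[OF DERIV_power[OF DERIV_inverse[OF False]]])
  from has_derivative_mult[OF C_fun_SucE(1)[OF assms(1)[unfolded One_nat_def]]
      this[unfolded has_field_derivative_def]]
  show ?thesis .
qed

context
  fixes f :: "complex \<Rightarrow> complex" and S :: "complex set" and r :: real
  assumes f: "C_fun 1 f" and S: "compact S" "\<And>z. z \<notin> S \<Longrightarrow> f z = 0"
    and r: "r > 0" "\<And>z. cmod z < r \<Longrightarrow> f z = 0"
begin

lemma pderiv_eq_0_off:
  "z \<notin> S \<Longrightarrow> pderiv_x f z = 0" "z \<notin> S \<Longrightarrow> pderiv_y f z = 0"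
  "cmod z < r \<Longrightarrow> pderiv_x f z = 0" "cmod z < r \<Longrightarrow> pderiv_y f z = 0"
  using pderiv_eq_0[of "- S" z f] pderiv_eq_0[of "ball 0 r" z f] S r compact_imp_closed[OF S(1)]
  by (auto simp: open_Compl)

lemma integrable_times_inverse_power:
  "integrable lborel (\<lambda>z. f z * inverse z ^ n)"
  "integrable lborel (\<lambda>z. pderiv_x f z * inverse z ^ n)"
  "integrable lborel (\<lambda>z. pderiv_y f z * inverse z ^ n)"
proof -
  have "continuous_on UNIV f" "continuous_on UNIV (pderiv_x f)" "continuous_on UNIV (pderiv_y f)"
    using C_fun_SucD[of 0 f] f by simp_all
  from this[THEN continuous_times_inverse_power[OF _ r(1)]]
  show "integrable lborel (\<lambda>z. f z * inverse z ^ n)"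
    "integrable lborel (\<lambda>z. pderiv_x f z * inverse z ^ n)"
    "integrable lborel (\<lambda>z. pderiv_y f z * inverse z ^ n)"
    by (auto intro!: integrable_compact_support[OF _ S(1)] simp: r S pderiv_eq_0_off)
qed

text \<open>The derivative of f z^(-n) in a fixed direction integrates to 0. The power contributes
  the factor -n z^(-n-1) in direction 1 and \<open>\<i>\<close> times that in direction
  \<open>\<i>\<close>.\<close>

lemma integral_pderiv_times_inverse_power:
  "(LINT z|lborel. pderiv_x f z * inverse z ^ n) = of_nat n * (LINT z|lborel. f z * inverse z ^ (n + 1))"
  "(LINT z|lborel. pderiv_y f z * inverse z ^ n) = \<i> * of_nat n * (LINT z|lborel. f z * inverse z ^ (n + 1))"
proof -
  have c: "continuous_on UNIV f" "continuous_on UNIV (pderiv_x f)" "continuous_on UNIV (pderiv_y f)"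
    using C_fun_SucD[of 0 f] f by simp_all
  have cf: "continuous_on UNIV (\<lambda>z. f z * inverse z ^ (n + 1))"
    by (rule continuous_times_inverse_power[OF c(1) r])
  have cp: "continuous_on UNIV (\<lambda>z. (of_real (Re w) * pderiv_x f z + of_real (Im w) * pderiv_y f z) * inverse z ^ n)" for w
    by (rule continuous_times_inverse_power[OF _ r(1)])
       (auto intro!: continuous_intros c simp: pderiv_eq_0_off)
  define D where "D z w = f z * (- of_nat n * inverse z ^ (n + 1) * w)
      + (of_real (Re w) * pderiv_x f z + of_real (Im w) * pderiv_y f z) * inverse z ^ n" for z w
  have D0: "(LINT z|lborel. D z w) = 0" for w
  proof (rule integral_directional_derivative_eq_0[OF _ _ S(1)])
    show "((\<lambda>z. f z * inverse z ^ n) has_derivative D z) (at z)" for z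
      unfolding D_def using f r by (rule has_derivative_times_inverse_power)
    have "D z w = f z * inverse z ^ (n + 1) * (- of_nat n * w)
      + (of_real (Re w) * pderiv_x f z + of_real (Im w) * pderiv_y f z) * inverse z ^ n" for z
      by (simp add: D_def)
    then show "continuous_on UNIV (\<lambda>z. D z w)"
      by (simp only:) (intro continuous_on_add continuous_on_mult_right cf cp)
  qed (simp add: S)
  note [simp] = integrable_times_inverse_power[of n] integrable_times_inverse_power(1)[of "n + 1", simplified]
  have "D z 1 = pderiv_x f z * inverse z ^ n - of_nat n * (f z * inverse z ^ (n + 1))"
    and "D z \<i> = pderiv_y f z * inverse z ^ n - \<i> * of_nat n * (f z * inverse z ^ (n + 1))" for z
    by (simp_all add: D_def)
  with D0[of 1] D0[of \<i>]
  show "(LINT z|lborel. pderiv_x f z * inverse z ^ n) = of_nat n * (LINT z|lborel. f z * inverse z ^ (n + 1))"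
    "(LINT z|lborel. pderiv_y f z * inverse z ^ n) = \<i> * of_nat n * (LINT z|lborel. f z * inverse z ^ (n + 1))"
    by simp_all
qed

text \<open>Since z^(-n) is holomorphic off 0, the two contributions cancel: n + i^2 n = 0.\<close>

lemma integral_dbar_times_inverse_power: "(LINT z|lborel. dbar f z * inverse z ^ n) = 0"
proof -
  have "dbar f z * inverse z ^ n
      = (pderiv_x f z * inverse z ^ n + \<i> * (pderiv_y f z * inverse z ^ n)) / 2" for z
    by (simp add: dbar_def algebra_simps add_divide_distrib)
  then have "(LINT z|lborel. dbar f z * inverse z ^ n)
    = (LINT z|lborel. (pderiv_x f z * inverse z ^ n + \<i> * (pderiv_y f z * inverse z ^ n)) / 2)"
    by (simp only:)
  also have "\<dots> = ((LINT z|lborel. pderiv_x f z * inverse z ^ n) + \<i> * (LINT z|lborel. pderiv_y f z * inverse z ^ n)) / 2"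
    using integrable_times_inverse_power[of n] by simp
  finally show ?thesis
    by (simp add: integral_pderiv_times_inverse_power mult.assoc)
qed

text \<open>The operator is the Wirtinger derivative d/dz, for which the contributions add up: n -
  i^2 n = 2 n.\<close>

lemma integral_d_times_inverse_power:
  "(LINT z|lborel. (pderiv_x f z - \<i> * pderiv_y f z) / 2 * inverse z ^ n)
    = of_nat n * (LINT z|lborel. f z * inverse z ^ (n + 1))"
proof -
  have "(pderiv_x f z - \<i> * pderiv_y f z) / 2 * inverse z ^ n
      = (pderiv_x f z * inverse z ^ n - \<i> * (pderiv_y f z * inverse z ^ n)) / 2" for z
    by (simp add: algebra_simps diff_divide_distrib)
  then have "(LINT z|lborel. (pderiv_x f z - \<i> * pderiv_y f z) / 2 * inverse z ^ n)
    = (LINT z|lborel. (pderiv_x f z * inverse z ^ n - \<i> * (pderiv_y f z * inverse z ^ n)) / 2)"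
    by (simp only:)
  also have "\<dots> = ((LINT z|lborel. pderiv_x f z * inverse z ^ n) - \<i> * (LINT z|lborel. pderiv_y f z * inverse z ^ n)) / 2"
    using integrable_times_inverse_power[of n] by simp
  finally show ?thesis
    by (simp add: integral_pderiv_times_inverse_power mult.assoc)
qed

end

text \<open>With \<open>f = z k(|z|\<^sup>2)\<close> and \<open>g = cnj z k(|z|\<^sup>2)\<close>, the \<open>z\<close>-derivative of \<open>f\<close> equals \<open>dbar g\<close>, so
  integrating by parts twice kills the moment.\<close>

lemma radial_moment_eq_0:
  assumes k: "C_real 1 k" and ab: "a > 0" "\<And>s. s \<le> a \<Longrightarrow> k s = 0" "\<And>s. s \<ge> b \<Longrightarrow> k s = 0"
    and n: "n \<ge> 1"
  shows "(LINT z|lborel. z * of_real (k ((cmod z)\<^sup>2)) * inverse z ^ (n + 1)) = 0"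
proof -
  let ?k = "\<lambda>z. complex_of_real (k ((cmod z)\<^sup>2))"
  define f where "f z = z * ?k z" for z
  define g where "g z = cnj z * ?k z" for z
  from k obtain k' where k': "\<And>s. (k has_real_derivative k' s) (at s)"
    by auto
  have k_deriv: "(?k has_derivative (\<lambda>w. of_real (Re w) * of_real (k' ((cmod z)\<^sup>2) * (2 * Re z))
      + of_real (Im w) * of_real (k' ((cmod z)\<^sup>2) * (2 * Im z)))) (at z)" for z
    using has_derivative_radial[OF k', where z=z and c=0] by simp
  have f': "(f has_derivative (\<lambda>w. of_real (Re w) * (?k z + z * of_real (k' ((cmod z)\<^sup>2) * (2 * Re z)))
      + of_real (Im w) * (\<i> * ?k z + z * of_real (k' ((cmod z)\<^sup>2) * (2 * Im z))))) (at z)" for z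
    unfolding f_def
    by (rule has_derivative_eq_rhs[OF has_derivative_mult[OF has_derivative_ident k_deriv]])
       (simp add: fun_eq_iff complex_eq_iff algebra_simps)
  have g': "(g has_derivative (\<lambda>w. of_real (Re w) * (?k z + cnj z * of_real (k' ((cmod z)\<^sup>2) * (2 * Re z)))
      + of_real (Im w) * (- \<i> * ?k z + cnj z * of_real (k' ((cmod z)\<^sup>2) * (2 * Im z))))) (at z)" for z
    unfolding g_def
    by (rule has_derivative_eq_rhs[OF has_derivative_mult[OF
            has_derivative_cnj[OF has_derivative_ident] k_deriv]])
       (simp add: fun_eq_iff complex_eq_iff algebra_simps)
  \<comment> \<open>Both sides are k(|z|^2) + |z|^2 k'(|z|^2).\<close>
  have eq: "dbar g z = (pderiv_x f z - \<i> * pderiv_y f z) / 2" for z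
    unfolding dbar_def pderiv_eqI[OF f'] pderiv_eqI[OF g']
    by (simp add: complex_eq_iff algebra_simps)
  have kC: "C_fun 1 ?k"
    using C_fun_radial[OF k, of 0] by simp
  \<comment> \<open>For c = i and c = -i these are z and its conjugate.\<close>
  have id: "C_fun 1 (\<lambda>z. of_real (Re z) + c * of_real (Im z))" for c
    by (intro C_fun_add C_fun_cmult C_fun_Re C_fun_Im)
  have "f = (\<lambda>z. (of_real (Re z) + \<i> * of_real (Im z)) * ?k z)"
    "g = (\<lambda>z. (of_real (Re z) + (- \<i>) * of_real (Im z)) * ?k z)"
    by (auto simp: f_def g_def fun_eq_iff complex_eq_iff)
  then have C: "C_fun 1 f" "C_fun 1 g"
    using C_fun_mult[OF id kC] by (simp_all only:)
  \<comment> \<open>No sign is assumed for \<open>b\<close>; the absolute value keeps the square of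
    the radius at least \<open>b\<close>.\<close>
  have off: "k ((cmod z)\<^sup>2) = 0" if "z \<notin> cball 0 (sqrt \<bar>b\<bar>)" for z
  proof (rule ab(3))
    have "\<bar>b\<bar> < (cmod z)\<^sup>2"
      using that real_sqrt_less_iff[of "\<bar>b\<bar>" "(cmod z)\<^sup>2"] by simp
    then show "b \<le> (cmod z)\<^sup>2"
      by linarith
  qed
  have near: "k ((cmod z)\<^sup>2) = 0" if "cmod z < sqrt a" for z
  proof (rule ab(2))
    show "(cmod z)\<^sup>2 \<le> a"
      using that real_sqrt_less_iff[of "(cmod z)\<^sup>2" a] by simp
  qed
  \<comment> \<open>The chain shows that n times the moment is 0, and n \<ge> 1 allows cancelling
    n.\<close>
  have "of_nat n * (LINT z|lborel. f z * inverse z ^ (n + 1))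
      = (LINT z|lborel. (pderiv_x f z - \<i> * pderiv_y f z) / 2 * inverse z ^ n)"
    by (rule integral_d_times_inverse_power[OF C(1) compact_cball[of 0 "sqrt \<bar>b\<bar>"], of "sqrt a", symmetric])
       (use ab(1) in \<open>auto simp: f_def off near\<close>)
  also have "\<dots> = (LINT z|lborel. dbar g z * inverse z ^ n)"
    by (simp add: eq)
  also have "\<dots> = 0"
    by (rule integral_dbar_times_inverse_power[OF C(2) compact_cball[of 0 "sqrt \<bar>b\<bar>"], of "sqrt a"])
       (use ab(1) in \<open>auto simp: g_def off near\<close>)
  finally show ?thesis
    using n by (simp add: f_def)
qed

section \<open>The Neumann series\<close>

lemma norm_power_bop_le: "norm (A ^ n) \<le> norm (A :: 'a::complex_normed_vector bop) ^ n"
proof (induction n)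
  case 0
  \<comment> \<open>Only an inequality: on the zero space the identity has norm 0.\<close>
  show ?case
    by (simp, transfer, rule norm_blinfun_id_le)
next
  case (Suc n)
  have "norm (A * A ^ n) \<le> norm A * norm (A ^ n)"
    by (rule norm_mult_ineq)
  also have "\<dots> \<le> norm A * norm A ^ n"
    using Suc by (rule mult_left_mono) simp
  finally show ?case
    by simp
qed

lemma summable_neumann_bound:
  fixes a r :: real
  assumes "0 \<le> a" "a < r"
  shows "summable (\<lambda>n. inverse r ^ (n + 1) * a ^ n)"
proof -
  have "summable (\<lambda>n. inverse r * (a / r) ^ n)"
    using assms by (intro summable_mult summable_geometric) auto
  then show ?thesis
    by (simp add: power_divide field_simps)
qed

text \<open>Multiplying the n-th term by z - A on either side gives z^(-n) A^n - z^(-n-1) A^(n+1),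
  so the series telescopes to 1.\<close>

lemma neumann_series:
  fixes A :: "'a::complex_banach bop"
  assumes "norm A < cmod z"
  shows "z \<in> resolvent_set A"
    and "(\<lambda>n. inverse z ^ (n + 1) *\<^sub>C A ^ n) sums resolvent A z"
proof -
  from assms have "z \<noteq> 0"
    by auto
  define b where "b n = inverse z ^ n *\<^sub>C A ^ n" for n
  define a where "a n = inverse z ^ (n + 1) *\<^sub>C A ^ n" for n
  have norm_a: "norm (a n) \<le> inverse (cmod z) ^ (n + 1) * norm A ^ n" for n
    using norm_power_bop_le[of A n]
    by (simp add: a_def norm_scaleC norm_mult norm_power norm_inverse mult_left_mono)
  have sm: "summable (\<lambda>n. inverse (cmod z) ^ (n + 1) * norm A ^ n)"
    using assms by (intro summable_neumann_bound) auto
  have "summable a"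
    using norm_a by (intro summable_comparison_test'[OF sm]) auto
  then have a: "a sums suminf a"
    by (rule summable_sums)
  \<comment> \<open>The telescoping terms are z times those of a summable series, hence tend to
    0.\<close>
  have "b = (\<lambda>n. z *\<^sub>C a n)"
    using \<open>z \<noteq> 0\<close> by (simp add: fun_eq_iff a_def b_def scaleC_scaleC flip: mult.assoc)
  moreover have "(\<lambda>n. z *\<^sub>C a n) \<longlonglongrightarrow> z *\<^sub>C 0"
    by (intro scaleC.tendsto tendsto_const summable_LIMSEQ_zero \<open>summable a\<close>)
  ultimately have "b \<longlonglongrightarrow> 0"
    by (simp add: scaleC.zero_right)
  then have b: "(\<lambda>n. b n - b (Suc n)) sums 1"
    using telescope_sums'[of b 0] by (simp add: b_def scaleC_of_real[of 1, simplified])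
  have A: "(z *\<^sub>C 1 - A) * a n = b n - b (Suc n)" "a n * (z *\<^sub>C 1 - A) = b n - b (Suc n)" for n
  proof -
    have z: "z * (inverse z * inverse z ^ n) = inverse z ^ n"
      using \<open>z \<noteq> 0\<close> by (simp flip: mult.assoc)
    then have z': "inverse z * inverse z ^ n * z = inverse z ^ n"
      by (simp add: mult.commute)
    show "(z *\<^sub>C 1 - A) * a n = b n - b (Suc n)" "a n * (z *\<^sub>C 1 - A) = b n - b (Suc n)"
      by (simp_all add: a_def b_def left_diff_distrib right_diff_distrib scaleC_mult_bop
          scaleC_scaleC scaleC.diff_right power_commutes z z')
  qed
  have 1: "(z *\<^sub>C 1 - A) * suminf a = 1"
    using sums_unique2[OF sums_mult[OF a] b[folded A(1)]] .
  have 2: "suminf a * (z *\<^sub>C 1 - A) = 1"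
    using sums_unique2[OF sums_mult2[OF a] b[folded A(2)]] .
  from 1 2 show "z \<in> resolvent_set A"
    by (auto simp: resolvent_set_def)
  \<comment> \<open>Uniqueness of two-sided inverses resolves the definite description.\<close>
  have "resolvent A z = suminf a"
    unfolding resolvent_def
  proof (rule the_equality)
    fix B
    assume "(z *\<^sub>C 1 - A) * B = 1 \<and> B * (z *\<^sub>C 1 - A) = 1"
    then have "B = B * ((z *\<^sub>C 1 - A) * suminf a)"
      using 1 by simp
    also have "\<dots> = suminf a"
      using \<open>_ \<and> _\<close> by (simp flip: mult.assoc)
    finally show "B = suminf a" .
  qed (use 1 2 in simp)
  with a show "(\<lambda>n. inverse z ^ (n + 1) *\<^sub>C A ^ n) sums resolvent A z"
    by (simp add: a_def[abs_def])
qed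

text \<open>The Neumann series is integrated term by term: the moment assumption kills every term
  except n = 0, where A^0 = 1.\<close>

lemma integral_scaleC_resolvent:
  fixes A :: "'a::complex_banach bop"
  assumes g: "continuous_on UNIV g"
    and S: "compact S" "\<And>z. z \<in> S \<Longrightarrow> norm A < cmod z" "\<And>z. z \<notin> S \<Longrightarrow> g z = 0"
    and moments: "\<And>n. n \<ge> 1 \<Longrightarrow> (LINT z|lborel. g z * inverse z ^ (n + 1)) = 0"
  shows "integral UNIV (\<lambda>z. g z *\<^sub>C resolvent A z) = (LINT z|lborel. g z * inverse z) *\<^sub>C 1"
proof -
  \<comment> \<open>Compactness gives a gap between norm A and \<open>S\<close>, which makes the
    geometric majorant uniform. For empty \<open>S\<close> any radius above norm A serves.\<close>
  obtain r where r: "norm A < r" "\<And>z. z \<in> S \<Longrightarrow> r \<le> cmod z"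
  proof (cases "S = {}")
    case True
    with that[of "norm A + 1"] show ?thesis
      by simp
  next
    case False
    then obtain w where "w \<in> S" "\<And>z. z \<in> S \<Longrightarrow> cmod w \<le> cmod z"
      using continuous_attains_inf[OF S(1), of cmod] by (auto intro: continuous_intros)
    with that[of "cmod w"] S(2) show ?thesis
      by simp
  qed
  then have r0: "r > 0"
    using norm_ge_zero[of A] by linarith
  have g0: "g z = 0" if "cmod z < r" for z
    using that r(2)[of z] S(3)[of z] by fastforce
  have cg: "continuous_on UNIV (\<lambda>z. g z * inverse z ^ n)" for n
    by (rule continuous_times_inverse_power[OF g r0 g0])
  obtain G where G: "\<And>z. cmod (g z) \<le> G" "G \<ge> 0"
  proof -
    have "bounded (g ` S)"
      by (intro compact_imp_bounded compact_continuous_image S continuous_on_subset[OF g]) auto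
    then obtain G where "G > 0" "\<And>z. z \<in> S \<Longrightarrow> cmod (g z) \<le> G"
      by (auto simp: bounded_pos)
    moreover from this have "cmod (g z) \<le> G" for z
      using S(3)[of z] by (cases "z \<in> S") auto
    ultimately show ?thesis
      using that[of G] by simp
  qed
  define F where "F n z = (g z * inverse z ^ (n + 1)) *\<^sub>C A ^ n" for n z
  \<comment> \<open>Where \<open>g\<close> vanishes, \<open>resolvent A z\<close> may be an
    unspecified value, but it is multiplied by 0.\<close>
  have F: "(\<lambda>n. F n z) sums (g z *\<^sub>C resolvent A z)" for z
  proof (cases "g z = 0")
    case True
    then show ?thesis
      by (simp add: F_def scaleC.zero_left)
  next
    case False
    then have "norm A < cmod z"
      using S by auto
    from bounded_linear.sums[OF scaleC.bounded_linear_right neumann_series(2)[OF this], of "g z"]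
    show ?thesis
      by (simp only: F_def scaleC_scaleC)
  qed
  have norm_F: "norm (F n z) \<le> G * (inverse r ^ (n + 1) * norm A ^ n)" for n z
  proof (cases "g z = 0")
    case True
    then show ?thesis
      using r0 G(2) by (simp add: F_def scaleC.zero_left)
  next
    case False
    then have "r \<le> cmod z"
      using g0[of z] by force
    then have "inverse (cmod z) ^ (n + 1) \<le> inverse r ^ (n + 1)"
      using r0 by (intro power_mono le_imp_inverse_le) auto
    then have "cmod (g z) * (inverse (cmod z) ^ (n + 1) * norm (A ^ n))
        \<le> G * (inverse r ^ (n + 1) * norm A ^ n)"
      using r0 G by (intro mult_mono norm_power_bop_le) auto
    then show ?thesis
      by (simp add: F_def norm_scaleC norm_mult norm_power norm_inverse mult.assoc)
  qed
  have "uniform_limit UNIV (\<lambda>N z. \<Sum>n<N. F n z) (\<lambda>z. \<Sum>n. F n z) sequentially"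
    using norm_F summable_mult[OF summable_neumann_bound[OF norm_ge_zero r(1)], of G]
    by (rule Weierstrass_m_test)
  moreover have "(\<Sum>n. F n z) = g z *\<^sub>C resolvent A z" for z
    using sums_unique[OF F] ..
  ultimately have lim: "uniform_limit UNIV (\<lambda>N z. \<Sum>n<N. F n z) (\<lambda>z. g z *\<^sub>C resolvent A z) sequentially"
    by simp
  \<comment> \<open>The exchange of uniform limit and integral takes place on a box, which loses
    nothing if it contains \<open>S\<close>.\<close>
  obtain c where c: "S \<subseteq> cbox (- c) c"
    using bounded_subset_cbox_symmetric[OF compact_imp_bounded[OF S(1)]] by blast
  have F_integral: "(F n has_integral (LINT z|lborel. g z * inverse z ^ (n + 1)) *\<^sub>C A ^ n) UNIV" for n
  proof -
    have "integrable lborel (\<lambda>z. g z * inverse z ^ (n + 1))"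
      by (rule integrable_compact_support[OF cg S(1)]) (simp add: S(3))
    from has_integral_linear[OF has_integral_integral_lborel[OF this]
        scaleC.bounded_linear_left[of "A ^ n"]]
    show ?thesis
      by (simp add: o_def F_def[abs_def])
  qed
  have F_S: "F n z = 0" if "z \<notin> S" for n z
    using S(3)[OF that] by (simp add: F_def scaleC.zero_left)
  have sum_integral: "((\<lambda>z. \<Sum>n<N. F n z) has_integral
      (\<Sum>n<N. (LINT z|lborel. g z * inverse z ^ (n + 1)) *\<^sub>C A ^ n)) (cbox (- c) c)" for N
  proof -
    have "((\<lambda>z. \<Sum>n<N. F n z) has_integral
        (\<Sum>n<N. (LINT z|lborel. g z * inverse z ^ (n + 1)) *\<^sub>C A ^ n)) UNIV"
      by (intro has_integral_sum F_integral) simp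
    moreover have "(\<Sum>n<N. F n z) = 0" if "z \<notin> cbox (- c) c" for z
      using c that F_S[of z] by (intro sum.neutral) blast
    then have "(\<lambda>z. if z \<in> cbox (- c) c then \<Sum>n<N. F n z else 0) = (\<lambda>z. \<Sum>n<N. F n z)"
      by (simp add: fun_eq_iff)
    ultimately show ?thesis
      by (subst has_integral_restrict_UNIV[symmetric]) simp
  qed
  obtain I J where IJ: "\<And>N. ((\<lambda>z. \<Sum>n<N. F n z) has_integral I N) (cbox (- c) c)"
    "((\<lambda>z. g z *\<^sub>C resolvent A z) has_integral J) (cbox (- c) c)" "I \<longlonglongrightarrow> J"
  proof (rule uniform_limit_integral_cbox)
    show "uniform_limit (cbox (- c) c) (\<lambda>N z. \<Sum>n<N. F n z) (\<lambda>z. g z *\<^sub>C resolvent A z) sequentially"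
      using lim by (rule uniform_limit_on_subset) simp
    show "continuous_on (cbox (- c) c) (\<lambda>z. \<Sum>n<N. F n z)" for N
      unfolding F_def
      by (intro continuous_on_sum scaleC.continuous_on continuous_on_const
          continuous_on_subset[OF cg]) auto
  qed auto
  \<comment> \<open>The empty partial sum at index 0 lacks the term A^0; from index 1 on the
    integrals are constant.\<close>
  have "I (Suc N) = (LINT z|lborel. g z * inverse z) *\<^sub>C 1" for N
  proof -
    have "I (Suc N) = (\<Sum>n<Suc N. (LINT z|lborel. g z * inverse z ^ (n + 1)) *\<^sub>C A ^ n)"
      using has_integral_unique[OF IJ(1) sum_integral] .
    also have "\<dots> = (\<Sum>n<Suc N. if n = 0 then (LINT z|lborel. g z * inverse z) *\<^sub>C 1 else 0)"
      using moments by (intro sum.cong) (auto simp: scaleC.zero_left simp del: power_Suc)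
    finally show ?thesis
      by simp
  qed
  then have "(\<lambda>N. I (Suc N)) \<longlonglongrightarrow> (LINT z|lborel. g z * inverse z) *\<^sub>C 1"
    by simp
  with LIMSEQ_Suc[OF IJ(3)] have "J = (LINT z|lborel. g z * inverse z) *\<^sub>C 1"
    by (rule LIMSEQ_unique)
  moreover have "((\<lambda>z. g z *\<^sub>C resolvent A z) has_integral J) UNIV"
  proof (rule has_integral_on_superset[OF IJ(2)])
    show "g z *\<^sub>C resolvent A z = 0" if "z \<notin> cbox (- c) c" for z
    proof -
      have "z \<notin> S"
        using c that by blast
      then show ?thesis
        by (simp add: S(3) scaleC.zero_left)
    qed
  qed simp
  ultimately show ?thesis
    by (simp add: integral_unique)
qed

section \<open>The spectral distribution outside the disc of radius \<open>\<parallel>A\<parallel>\<close>\<close>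

text \<open>Every z^(-n) is holomorphic on the support of \<open>\<phi>\<close>, so integration by
  parts annihilates all terms of the series, the one for z^(-1) included.\<close>

lemma spectral_distribution_eq_0:
  fixes A :: "'a::complex_banach bop"
  assumes "extends_resolvent R A" "\<phi> \<in> test_funs" "fun_support \<phi> \<subseteq> {z. norm A < cmod z}"
  shows "spectral_distribution R \<phi> = 0"
proof -
  let ?S = "fun_support \<phi>"
  note D = dbar_in_test_funs[OF assms(2)]
  have S: "compact ?S"
    using assms(2) by (rule test_funsD)
  \<comment> \<open>The powers require \<open>\<phi>\<close> to vanish near 0. If A is nonzero, norm
    A is such a radius; otherwise 0 merely lies in the open complement of the support.\<close>
  obtain r where r: "r > 0" "\<And>z. cmod z < r \<Longrightarrow> \<phi> z = 0"
  proof (cases "A = 0")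
    case True
    have "open (- ?S)" "0 \<in> - ?S"
      using assms(3) True by (auto simp: fun_support_def)
    then obtain r where "r > 0" "ball 0 r \<subseteq> - ?S"
      using open_contains_ball by blast
    with that[of r] show ?thesis
      using eq_0_outside_fun_support[of _ \<phi>] by (auto simp: subset_iff)
  next
    case False
    with that[of "norm A"] assms(3) eq_0_outside_fun_support[of _ \<phi>] show ?thesis
      by fastforce
  qed
  have moment: "(LINT z|lborel. dbar \<phi> z * inverse z ^ n) = 0" for n
    using test_funsD(1)[OF assms(2), of 1] S eq_0_outside_fun_support r
    by (rule integral_dbar_times_inverse_power)
  have "fun_support (dbar \<phi>) \<subseteq> resolvent_set A"
    using fun_support_dbar[of \<phi>] assms(3) neumann_series(1)[of A] by blast
  with assms(1) D have "R (dbar \<phi>) = integral UNIV (\<lambda>z. dbar \<phi> z *\<^sub>C resolvent A z)"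
    by (simp add: extends_resolvent_def)
  also have "\<dots> = (LINT z|lborel. dbar \<phi> z * inverse z) *\<^sub>C 1"
  proof (rule integral_scaleC_resolvent[OF _ S])
    show "continuous_on UNIV (dbar \<phi>)"
      using test_funsD(1)[OF D, of 0] by simp
  qed (use assms(3) moment dbar_eq_0_outside_fun_support in \<open>auto simp del: power_Suc\<close>)
  also have "\<dots> = 0"
    using moment[of 1] by (simp add: scaleC.zero_left)
  finally show ?thesis
    by (simp add: spectral_distribution_def dist_dbar_def)
qed

text \<open>Only the moment against z^(-1) survives: it is pi (h b - h 0) = -pi. The sign cancels
  against that of \<open>dist_dbar\<close>, and pi against the factor 1/pi.\<close>

lemma spectral_distribution_radial_cutoff:
  fixes A :: "'a::complex_banach bop"
  assumes R: "extends_resolvent R A"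
    and h: "\<And>k. C_real k h" "\<And>s. s \<le> a \<Longrightarrow> h s = 1" "\<And>s. s \<ge> b \<Longrightarrow> h s = 0"
    and a: "(norm A)\<^sup>2 < a" "a < b"
  shows "spectral_distribution R (\<lambda>z. of_real (h ((cmod z)\<^sup>2))) = 1"
proof -
  define \<eta> where "\<eta> z = complex_of_real (h ((cmod z)\<^sup>2))" for z
  have "a > 0"
    using a(1) zero_le_power2[of "norm A"] by linarith
  \<comment> \<open>Two derivatives of \<open>h\<close>, because \<open>radial_moment_eq_0\<close>
    asks for a C^1 profile.\<close>
  obtain h' where h': "\<And>s. (h has_real_derivative h' s) (at s)" "C_real 1 h'"
    using h(1)[of 2] by (auto simp: numeral_2_eq_2)
  have h'_off: "h' s = 0" if "s < a \<or> s > b" for s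
  proof -
    have "((\<lambda>s. h s) has_real_derivative 0) (at s)"
    proof (cases "s < a")
      case True
      with h(2) show ?thesis
        by (intro has_field_derivative_transform_within_open[OF DERIV_const[of 1], of "{..<a}"]) auto
    next
      case False
      with h(3) that show ?thesis
        by (intro has_field_derivative_transform_within_open[OF DERIV_const[of 0], of "{b<..}"]) auto
    qed
    then show ?thesis
      using h'(1) DERIV_unique by blast
  qed
  have ch': "continuous_on UNIV h'"
    using C_real_SucD[of 0 h'] h'(2) by simp
  \<comment> \<open>Constancy of \<open>h\<close> gives this on the open half-lines; continuity
    extends it to the endpoints \<open>a\<close> and \<open>b\<close>.\<close>
  have h'0: "h' s = 0" if "s \<le> a \<or> s \<ge> b" for s
  proof -
    have "closed {s. h' s = 0}"
      using ch' by (intro closed_Collect_eq continuous_on_const)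
    moreover have "{..<a} \<union> {b<..} \<subseteq> {s. h' s = 0}"
      using h'_off by auto
    ultimately have "closure ({..<a} \<union> {b<..}) \<subseteq> {s. h' s = 0}"
      by (rule closure_minimal[rotated])
    with that show ?thesis
      by auto
  qed
  define S where "S = cball 0 (sqrt b) - ball (0::complex) (sqrt a)"
  have S: "compact S"
    unfolding S_def by (intro compact_diff compact_cball open_ball)
  have z_S: "a \<le> (cmod z)\<^sup>2" if "z \<in> S" for z
    using that real_sqrt_le_iff[of a "(cmod z)\<^sup>2"] by (simp add: S_def)
  have off_S: "(cmod z)\<^sup>2 \<le> a \<or> (cmod z)\<^sup>2 \<ge> b" if "z \<notin> S" for z
    using that real_sqrt_le_iff[of "(cmod z)\<^sup>2" b] real_sqrt_le_iff[of a "(cmod z)\<^sup>2"]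
    by (auto simp: S_def)
  have S_A: "norm A < cmod z" if "z \<in> S" for z
    using z_S[OF that] a(1) by (intro power2_less_imp_less[of "norm A"]) auto
  have dbar_\<eta>: "dbar \<eta> = (\<lambda>z. z * of_real (h' ((cmod z)\<^sup>2)))"
  proof
    fix z
    show "dbar \<eta> z = z * of_real (h' ((cmod z)\<^sup>2))"
      using pderiv_eqI[OF has_derivative_radial[OF h'(1), where z=z and c=0]]
      by (simp add: dbar_def \<eta>_def[abs_def] complex_eq_iff)
  qed
  have off_dbar: "dbar \<eta> z = 0" if "z \<notin> S" for z
    using h'0[OF off_S[OF that]] by (simp add: dbar_\<eta>)
  have \<eta>: "C_fun k \<eta>" for k
    using C_fun_radial[OF h(1), of k 0] by (simp add: \<eta>_def[abs_def])
  have D: "dbar \<eta> \<in> test_funs"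
    by (rule test_funsI[OF C_fun_dbar[OF \<eta>] S off_dbar])
  have "fun_support (dbar \<eta>) \<subseteq> S"
    using compact_imp_closed[OF S] off_dbar by (rule fun_support_subset)
  then have "fun_support (dbar \<eta>) \<subseteq> resolvent_set A"
    using S_A neumann_series(1) by blast
  with R D have "R (dbar \<eta>) = integral UNIV (\<lambda>z. dbar \<eta> z *\<^sub>C resolvent A z)"
    by (simp add: extends_resolvent_def)
  also have "\<dots> = (LINT z|lborel. dbar \<eta> z * inverse z) *\<^sub>C 1"
  proof (rule integral_scaleC_resolvent[OF _ S S_A off_dbar])
    show "continuous_on UNIV (dbar \<eta>)"
      using test_funsD(1)[OF D, of 0] by simp
    show "(LINT z|lborel. dbar \<eta> z * inverse z ^ (n + 1)) = 0" if "n \<ge> 1" for n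
      unfolding dbar_\<eta> by (rule radial_moment_eq_0[OF h'(2) \<open>a > 0\<close> _ _ that, of b]) (simp_all add: h'0)
  qed
  \<comment> \<open>Here z cancels against its inverse. At z = 0 the left side is 0 by convention,
    and so is \<open>h' 0\<close>, since 0 < a.\<close>
  also have "(LINT z|lborel. dbar \<eta> z * inverse z) = (LINT z|lborel. complex_of_real (h' ((cmod z)\<^sup>2)))"
  proof (rule Bochner_Integration.integral_cong)
    show "dbar \<eta> z * inverse z = complex_of_real (h' ((cmod z)\<^sup>2))" for z
      using h'0[of 0] \<open>a > 0\<close> by (cases "z = 0") (simp_all add: dbar_\<eta>)
  qed simp
  also have "\<dots> = of_real (pi * (h b - h 0))"
    using h'(1) ch' by (rule integral_radial_derivative) (use \<open>a > 0\<close> a h'0 in auto)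
  also have "\<dots> = of_real (- pi)"
    using h(2)[of 0] h(3)[of b] \<open>a > 0\<close> by simp
  finally have "R (dbar \<eta>) = (- pi) *\<^sub>R 1"
    by (simp only: scaleC_of_real)
  then have "spectral_distribution R \<eta> = 1"
    by (simp add: spectral_distribution_def dist_dbar_def)
  then show ?thesis
    by (simp add: \<eta>_def[abs_def])
qed

section \<open>Compactness of the support and independence of the cutoff\<close>

theorem theorem2:
  fixes A :: "'v::complex_banach bop"
    and R M :: "(complex \<Rightarrow> complex) \<Rightarrow> 'v bop"
  assumes "resolvent_distribution R"
    and "extends_resolvent R A"
    and "M = spectral_distribution R"
  shows "compact (dist_support M) \<and> value_at_one M 1"
proof -
  have R: "distribution R"
    using assms(1) by (simp add: resolvent_distribution_def)
  have add: "M (\<lambda>z. \<phi> z + \<psi> z) = M \<phi> + M \<psi>" if "\<phi> \<in> test_funs" "\<psi> \<in> test_funs" for \<phi> \<psi>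
    unfolding assms(3) using R that by (rule spectral_distribution_add)
  have "open {z. norm A < cmod z}"
    by (intro open_Collect_less continuous_intros)
  \<comment> \<open>The exterior of the closed disc is one of the open sets removed in
    \<open>dist_support\<close>.\<close>
  then have supp: "dist_support M \<subseteq> cball 0 (norm A)"
    using spectral_distribution_eq_0[OF assms(2)] unfolding dist_support_def assms(3) by fastforce
  have "closed (dist_support M)"
    unfolding dist_support_def by (intro closed_Compl open_Union) auto
  with supp have compact: "compact (dist_support M)"
    by (metis compact_Int_closed compact_cball inf.absorb2)
  \<comment> \<open>Any value above the square of norm A would do; the strict excess makes the
    cutoff 1 on a neighborhood of the closed disc.\<close>
  define a where "a = (norm A)\<^sup>2 + 1"
  have "a < a + 1"
    by simp
  then obtain h where h: "\<And>k. C_real k h" "\<And>s. s \<le> a \<Longrightarrow> h s = 1" "\<And>s. s \<ge> a + 1 \<Longrightarrow> h s = 0"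
    by (rule smooth_step_exists) blast
  define \<eta> where "\<eta> z = complex_of_real (h ((cmod z)\<^sup>2))" for z
  have M\<eta>: "M \<eta> = 1"
    unfolding assms(3) \<eta>_def[abs_def]
    by (rule spectral_distribution_radial_cutoff[OF assms(2) h]) (auto simp: a_def)
  have \<eta>: "\<eta> \<in> cutoff_funs (dist_support M)"
  proof -
    have "\<eta> \<in> test_funs"
    proof (rule test_funsI[OF _ compact_cball[of 0 "sqrt (a + 1)"]])
      show "C_fun k \<eta>" for k
        using C_fun_radial[OF h(1), of k 0] by (simp add: \<eta>_def[abs_def])
      show "\<eta> z = 0" if "z \<notin> cball 0 (sqrt (a + 1))" for z
        using that real_sqrt_less_iff[of "a + 1" "(cmod z)\<^sup>2"] by (simp add: \<eta>_def h(3))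
    qed
    moreover have "dist_support M \<subseteq> ball 0 (sqrt a)"
    proof -
      have "norm A < sqrt a"
        using real_sqrt_less_iff[of "(norm A)\<^sup>2" a] by (simp add: a_def)
      with supp show ?thesis
        by fastforce
    qed
    moreover have "\<eta> z = 1" if "z \<in> ball 0 (sqrt a)" for z
      using that real_sqrt_less_iff[of "(cmod z)\<^sup>2" a] by (simp add: \<eta>_def h(2))
    ultimately show ?thesis
      unfolding cutoff_funs_def by blast
  qed
  have "M \<theta> = 1" if \<theta>: "\<theta> \<in> cutoff_funs (dist_support M)" for \<theta>
  proof -
    obtain U V where U: "open U" "dist_support M \<subseteq> U" "\<And>z. z \<in> U \<Longrightarrow> \<theta> z = 1"
      and V: "open V" "dist_support M \<subseteq> V" "\<And>z. z \<in> V \<Longrightarrow> \<eta> z = 1"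
      using \<theta> \<eta> unfolding cutoff_funs_def by blast
    have test: "\<theta> \<in> test_funs" "\<eta> \<in> test_funs"
      using \<theta> \<eta> by (auto simp: cutoff_funs_def)
    have diff: "(\<lambda>z. \<theta> z - \<eta> z) \<in> test_funs"
      using test by (rule test_funs_diff)
    \<comment> \<open>Both cutoffs are 1 on the open set \<open>U \<inter> V\<close>, which contains
      the support of \<open>M\<close>; thus their difference is supported off it and
      \<open>M\<close> gives both the same value.\<close>
    have "fun_support (\<lambda>z. \<theta> z - \<eta> z) \<subseteq> - (U \<inter> V)"
      using U V by (intro fun_support_subset closed_Compl open_Int) auto
    with U(2) V(2) have "M (\<lambda>z. \<theta> z - \<eta> z) = 0"
      by (intro eq_0_off_dist_support[OF add diff]) auto
    with add[OF test(2) diff] M\<eta> show ?thesis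
      by simp
  qed
  with \<eta> compact show ?thesis
    unfolding value_at_one_def by blast
qed

end
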